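(* Let $(X,d)$ be a (nonempty) compact quasihypermetric space. Then the following conditions are equivalent. (1) $M(X)<\infty$. (2) There exist $\mu\in\mathcal{M}_1(X)$ and $c\ge 0$ such that $|I(\mu,\nu)|\le c\,\|\nu\|$ for all $\nu\in E_0(X)$. (3) For all $\mu\in\mathcal{M}(X)$, there exists $c_\mu\ge 0$ such that $|I(\mu,\nu)|\le c_\mu\,\|\nu\|$ for all $\nu\in E_0(X)$. (4) There exists $K\ge 0$ such that $|I(\mu,\nu)|\le K\,\|\nu\|$ for all $\nu\in E_0(X)$ and for all $\mu\in\mathcal{M}_1^+(X)$. (5) There exists $c\ge 0$ such that $\|d_\nu\|_\infty\le c\,\|\nu\|$ for all $\nu\in E_0(X)$. (6) There exists $c\ge 0$ such that $|I(\mu_1)-I(\mu_2)|\le c\,\|\mu_1-\mu_2\|$ for all $\mu_1,\mu_2\in\mathcal{M}_1^+(X)$.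
   Context: A metric space $(X,d)$ is called quasihypermetric if for all $n\in\mathbb{N}$, all $\alpha_1,\dots,\alpha_n\in\mathbb{R}$ with $\sum_{i=1}^n\alpha_i=0$ and all $x_1,\dots,x_n\in X$ one has $\sum_{i,j=1}^n\alpha_i\alpha_j d(x_i,x_j)\le 0$. For a compact metric space $(X,d)$, $\mathcal{M}(X)$ is the space of all finite signed Borel measures on $X$; $\mathcal{M}_0(X)$ and $\mathcal{M}_1(X)$ are the sets of those of total mass $0$ and $1$ respectively; $\mathcal{M}_1^+(X)$ is the set of Borel probability measures on $X$. For $\mu,\nu\in\mathcal{M}(X)$, $I(\mu,\nu)=\int_X\int_X d(x,y)\,d\mu(x)\,d\nu(y)$, $I(\mu)=I(\mu,\mu)$, and $d_\mu(x)=\int_X d(x,y)\,d\mu(y)$ for $x\in X$ (a continuous function on $X$). $\|\cdot\|_\infty$ is the supremum norm. $M(X)=\sup\{I(\mu):\mu\in\mathcal{M}_1(X)\}$. When $(X,d)$ is compact quasihypermetric, $(\mu\mid\nu)=-I(\mu,\nu)$ is a semi-inner product (symmetric, positive semidefinite bilinear form) on $\mathcal{M}_0(X)$, with seminorm $\|\mu\|=[-I(\mu)]^{1/2}$; $E_0(X)$ denotes $\mathcal{M}_0(X)$ with this semi-inner product. *)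

theory Defs
  imports "HOL-Analysis.Analysis"
begin

definition quasihypermetric :: "'a::metric_space set \<Rightarrow> bool" where
  "quasihypermetric X \<longleftrightarrow>
     (\<forall>(n::nat) (\<alpha>::nat \<Rightarrow> real) (x::nat \<Rightarrow> 'a).
        (\<forall>i\<in>{1..n}. x i \<in> X) \<longrightarrow> (\<Sum>i=1..n. \<alpha> i) = 0 \<longrightarrow>
        (\<Sum>i=1..n. \<Sum>j=1..n. \<alpha> i * \<alpha> j * dist (x i) (x j)) \<le> 0)"

abbreviation borel_on :: "'a::topological_space set \<Rightarrow> 'a measure" where
  "borel_on X \<equiv> restrict_space borel X"

(* A finite signed Borel measure on X is a real-valued countably additive function on the
   Borel sets of X.  As for the library's measure, the value at non-measurable sets is fixed
   to 0, so that signed measures agreeing on all Borel sets are equal. *)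
definition signed_measures :: "'a::topological_space set \<Rightarrow> ('a set \<Rightarrow> real) set" where
  "signed_measures X =
     {\<mu>. \<mu> {} = 0 \<and>
         (\<forall>A :: nat \<Rightarrow> 'a set. range A \<subseteq> sets (borel_on X) \<longrightarrow> disjoint_family A \<longrightarrow>
            (\<lambda>i. \<mu> (A i)) sums \<mu> (\<Union>i. A i)) \<and>
         (\<forall>A. A \<notin> sets (borel_on X) \<longrightarrow> \<mu> A = 0)}"

definition signed_measures_0 :: "'a::topological_space set \<Rightarrow> ('a set \<Rightarrow> real) set" where
  "signed_measures_0 X = {\<mu> \<in> signed_measures X. \<mu> X = 0}"

definition signed_measures_1 :: "'a::topological_space set \<Rightarrow> ('a set \<Rightarrow> real) set" where
  "signed_measures_1 X = {\<mu> \<in> signed_measures X. \<mu> X = 1}"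

definition prob_measures :: "'a::topological_space set \<Rightarrow> ('a set \<Rightarrow> real) set" where
  "prob_measures X = {\<mu> \<in> signed_measures_1 X. \<forall>A\<in>sets (borel_on X). 0 \<le> \<mu> A}"

(* The Jordan decomposition: the positive part is A \<mapsto> sup {\<mu> B | B \<subseteq> A Borel}.  The set B = {}
   always competes, so truncating negative values of \<mu> B by ennreal does not change the
   supremum. *)
definition pos_variation :: "'a::topological_space set \<Rightarrow> ('a set \<Rightarrow> real) \<Rightarrow> 'a measure" where
  "pos_variation X \<mu> =
     measure_of X (sets (borel_on X)) (\<lambda>A. SUP B\<in>{B \<in> sets (borel_on X). B \<subseteq> A}. ennreal (\<mu> B))"

definition neg_variation :: "'a::topological_space set \<Rightarrow> ('a set \<Rightarrow> real) \<Rightarrow> 'a measure" where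
  "neg_variation X \<mu> = pos_variation X (\<lambda>A. - \<mu> A)"

definition signed_integral ::
    "'a::topological_space set \<Rightarrow> ('a set \<Rightarrow> real) \<Rightarrow> ('a \<Rightarrow> real) \<Rightarrow> real" where
  "signed_integral X \<mu> f = (LINT x|pos_variation X \<mu>. f x) - (LINT x|neg_variation X \<mu>. f x)"

definition mutual_energy ::
    "'a::metric_space set \<Rightarrow> ('a set \<Rightarrow> real) \<Rightarrow> ('a set \<Rightarrow> real) \<Rightarrow> real" where
  "mutual_energy X \<mu> \<nu> = signed_integral X \<nu> (\<lambda>y. signed_integral X \<mu> (\<lambda>x. dist x y))"

definition energy :: "'a::metric_space set \<Rightarrow> ('a set \<Rightarrow> real) \<Rightarrow> real" where
  "energy X \<mu> = mutual_energy X \<mu> \<mu>"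

definition potential :: "'a::metric_space set \<Rightarrow> ('a set \<Rightarrow> real) \<Rightarrow> 'a \<Rightarrow> real" where
  "potential X \<mu> x = signed_integral X \<mu> (\<lambda>y. dist x y)"

definition max_energy :: "'a::metric_space set \<Rightarrow> ereal" where
  "max_energy X = (SUP \<mu>\<in>signed_measures_1 X. ereal (energy X \<mu>))"

(* Only meaningful on signed_measures_0 X for compact quasihypermetric X, where the energy is
   nonpositive. *)
definition energy_seminorm :: "'a::metric_space set \<Rightarrow> ('a set \<Rightarrow> real) \<Rightarrow> real" where
  "energy_seminorm X \<nu> = sqrt (- energy X \<nu>)"

(* A supremum in the reals, hence only meaningful for nonempty X and f bounded on X; this holds
   for potentials of signed measures on a nonempty compact X. *)
definition sup_norm_on :: "'a set \<Rightarrow> ('a \<Rightarrow> real) \<Rightarrow> real" where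
  "sup_norm_on X f = (SUP x\<in>X. \<bar>f x\<bar>)"

end

theory Submission
  imports Defs
begin

text \<open>By bilinearity, \<open>t \<mapsto> I(\<mu> + t\<nu>) = I(\<mu>) + 2t I(\<mu>,\<nu>) - t\<^sup>2 \<parallel>\<nu>\<parallel>\<^sup>2\<close> for \<open>\<nu>\<close> of total mass 0, and quasihypermetricity
  extends to \<open>I(\<nu>) \<le> 0\<close> by cutting \<open>X\<close> into small pieces and replacing \<open>\<nu>\<close> by point masses.
  If the energy is bounded by \<open>M\<close> on measures of mass 1, the discriminant of this quadratic gives
  \<open>I(\<mu>,\<nu>)\<^sup>2 \<le> (M - I(\<mu>)) \<parallel>\<nu>\<parallel>\<^sup>2\<close>; as \<open>I(\<mu>) \<ge> 0\<close> for probability measures, the constant \<open>\<surd>M\<close> in (4) is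
  uniform. Conversely, a bound \<open>\<bar>I(\<mu>,\<nu>)\<bar> \<le> c\<parallel>\<nu>\<parallel>\<close> for a single \<open>\<mu>\<close> of mass 1 yields
  \<open>I(\<mu> + \<nu>) \<le> I(\<mu>) + 2c\<parallel>\<nu>\<parallel> - \<parallel>\<nu>\<parallel>\<^sup>2 \<le> I(\<mu>) + c\<^sup>2\<close>, and passes to every \<open>\<mu>\<close> by the Cauchy-Schwarz inequality.
  Condition (5) is (4) for point masses, and (6) comes from
  \<open>I(\<mu>\<^sub>1) - I(\<mu>\<^sub>2) = I(\<mu>\<^sub>1 + \<mu>\<^sub>2, \<mu>\<^sub>1 - \<mu>\<^sub>2)\<close>.\<close>

section \<open>The Jordan decomposition\<close>

lemma signed_measure_empty: "\<mu> \<in> signed_measures X \<Longrightarrow> \<mu> {} = 0"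
  by (simp add: signed_measures_def)

lemma signed_measure_sums:
  "\<mu> \<in> signed_measures X \<Longrightarrow> range A \<subseteq> sets (borel_on X) \<Longrightarrow> disjoint_family A \<Longrightarrow>
    (\<lambda>i::nat. \<mu> (A i)) sums \<mu> (\<Union>i. A i)"
  by (simp add: signed_measures_def)

lemma signed_measure_Un:
  assumes \<mu>: "\<mu> \<in> signed_measures X" and "A \<in> sets (borel_on X)" "B \<in> sets (borel_on X)" "A \<inter> B = {}"
  shows "\<mu> (A \<union> B) = \<mu> A + \<mu> B"
proof -
  have "(\<lambda>i. \<mu> (binaryset A B i)) sums \<mu> (\<Union>i. binaryset A B i)"
    using assms by (intro signed_measure_sums[OF \<mu>])
      (auto simp: range_binaryset_eq binaryset_def disjoint_family_on_def)
  moreover have "(\<lambda>i. \<mu> (binaryset A B i)) sums (\<mu> A + \<mu> B)"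
    by (rule binaryset_sums) (rule signed_measure_empty[OF \<mu>])
  ultimately show ?thesis
    by (simp add: UN_binaryset_eq sums_iff)
qed

lemma signed_measure_Diff:
  assumes "\<mu> \<in> signed_measures X" "A \<in> sets (borel_on X)" "B \<in> sets (borel_on X)" "B \<subseteq> A"
  shows "\<mu> (A - B) = \<mu> A - \<mu> B"
proof -
  have "(A - B) \<union> B = A" "(A - B) \<inter> B = {}" using assms(4) by auto
  then show ?thesis using signed_measure_Un[of \<mu> X "A - B" B] assms by simp
qed

lemma signed_measures_lincomb:
  assumes "\<mu> \<in> signed_measures X" "\<nu> \<in> signed_measures X"
  shows "(\<lambda>A. a * \<mu> A + b * \<nu> A) \<in> signed_measures X"
  using assms unfolding signed_measures_def
  by (auto intro!: sums_add sums_mult)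

lemma signed_measures_uminus: "\<mu> \<in> signed_measures X \<Longrightarrow> (\<lambda>A. - \<mu> A) \<in> signed_measures X"
  using signed_measures_lincomb[of \<mu> X \<mu> "-1" 0] by simp

text \<open>\<open>measure P\<close> is 0 off \<open>sets P\<close>, which is exactly the default
  value that a signed measure has to take there.\<close>

lemma measure_in_signed_measures:
  assumes "finite_measure P" "sets P = sets (borel_on X)"
  shows "measure P \<in> signed_measures X"
  using assms finite_measure.finite_measure_UNION[OF assms(1)]
  by (auto simp: signed_measures_def measure_notin_sets)

section \<open>The variations as finite measures\<close>

lemma space_pos_variation [simp]: "space (pos_variation X \<mu>) = X"
  unfolding pos_variation_def
  using sets.sigma_algebra_axioms[of "borel_on X"]
  by (subst space_measure_of) (auto simp: space_restrict_space sets_restrict_space)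

lemma sets_pos_variation [simp]: "sets (pos_variation X \<mu>) = sets (borel_on X)"
proof -
  have "sigma_algebra X (sets (borel_on X))"
    using sets.sigma_algebra_axioms[of "borel_on X"] by (simp add: space_restrict_space)
  then show ?thesis
    unfolding pos_variation_def by (rule sigma_algebra.sets_measure_of_eq)
qed

lemma space_neg_variation [simp]: "space (neg_variation X \<mu>) = X"
  by (simp add: neg_variation_def)

lemma sets_neg_variation [simp]: "sets (neg_variation X \<mu>) = sets (borel_on X)"
  by (simp add: neg_variation_def)

text \<open>\<open>measure_of\<close> returns the given set function only if it is countably
  additive, so this has to be shown for the supremum. Gluing competitors in disjoint sets gives
  superadditivity; cutting a competitor along the pieces of a countable union gives the reverse
  inequality.\<close>

lemma emeasure_pos_variation:
  assumes \<mu>: "\<mu> \<in> signed_measures X" and A: "A \<in> sets (borel_on X)"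
  shows "emeasure (pos_variation X \<mu>) A = (SUP B\<in>{B \<in> sets (borel_on X). B \<subseteq> A}. ennreal (\<mu> B))"
proof -
  let ?S = "sets (borel_on X)"
  define f where "f A = (SUP B\<in>{B \<in> ?S. B \<subseteq> A}. ennreal (\<mu> B))" for A
  have upper: "ennreal (\<mu> B) \<le> f A" if "B \<in> ?S" "B \<subseteq> A" for A B
    unfolding f_def using that by (intro SUP_upper) auto
  have f0: "f {} = 0"
    by (auto simp: f_def signed_measure_empty[OF \<mu>] intro!: antisym SUP_least)
  have superadd: "f A + f B \<le> f (A \<union> B)" if AB: "A \<in> ?S" "B \<in> ?S" "A \<inter> B = {}" for A B
  proof -
    \<comment> \<open>\<open>ennreal\<close> truncates at 0: if both values are nonnegative,
      \<open>C \<union> D\<close> competes for the union; otherwise one summand vanishes and the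
      other set competes alone.\<close>
    have le: "ennreal (\<mu> C) + ennreal (\<mu> D) \<le> f (A \<union> B)"
      if "C \<in> ?S" "D \<in> ?S" "C \<subseteq> A" "D \<subseteq> B" for C D
    proof -
      have "\<mu> (C \<union> D) = \<mu> C + \<mu> D"
        using that AB by (intro signed_measure_Un[OF \<mu>]) auto
      moreover have "ennreal (\<mu> C) \<le> f (A \<union> B)" "ennreal (\<mu> D) \<le> f (A \<union> B)"
        "ennreal (\<mu> (C \<union> D)) \<le> f (A \<union> B)"
        using that by (auto intro!: upper)
      ultimately show ?thesis
        by (cases "\<mu> C \<ge> 0"; cases "\<mu> D \<ge> 0") (auto simp: ennreal_neg ennreal_plus)
    qed
    have ne: "{B \<in> ?S. B \<subseteq> C} \<noteq> {}" for C
      by (auto intro!: exI[of _ "{}"])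
    have "f A + ennreal (\<mu> D) \<le> f (A \<union> B)" if "D \<in> ?S" "D \<subseteq> B" for D
      unfolding f_def[of A] using that le
      by (subst ennreal_SUP_add_left[symmetric, OF ne]) (auto intro!: SUP_least)
    then show ?thesis
      unfolding f_def[of B]
      by (subst ennreal_SUP_add_right[OF ne]) (auto intro!: SUP_least)
  qed
  have "countably_additive ?S f"
  proof (rule countably_additiveI)
    fix A :: "nat \<Rightarrow> 'a set"
    assume A: "range A \<subseteq> ?S" "disjoint_family A" "(\<Union>i. A i) \<in> ?S"
    have part: "(\<Sum>i<n. f (A i)) \<le> f (\<Union>i<n. A i)" for n
    proof (induction n)
      case (Suc n)
      have "(\<Sum>i<Suc n. f (A i)) \<le> f (\<Union>i<n. A i) + f (A n)"
        using Suc by (simp add: add_mono)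
      also have "\<dots> \<le> f ((\<Union>i<n. A i) \<union> A n)"
      proof (rule superadd)
        have "A i \<inter> A n = {}" if "i < n" for i
          using disjoint_family_onD[OF A(2), of i n] that by simp
        then show "(\<Union>i<n. A i) \<inter> A n = {}" by blast
      qed (use A(1) in auto)
      also have "(\<Union>i<n. A i) \<union> A n = (\<Union>i<Suc n. A i)"
        by (auto simp: less_Suc_eq)
      finally show ?case .
    qed (simp add: f0)
    show "(\<Sum>i. f (A i)) = f (\<Union>i. A i)"
    proof (rule antisym)
      show "(\<Sum>i. f (A i)) \<le> f (\<Union>i. A i)"
        unfolding suminf_eq_SUP
      proof (rule SUP_least)
        fix n
        have "f (\<Union>i<n. A i) \<le> f (\<Union>i. A i)"
          unfolding f_def by (rule SUP_subset_mono) auto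
        then show "(\<Sum>i<n. f (A i)) \<le> f (\<Union>i. A i)"
          using part order_trans by blast
      qed
      show "f (\<Union>i. A i) \<le> (\<Sum>i. f (A i))"
        unfolding f_def[of "\<Union>i. A i"]
      proof (rule SUP_least, clarify)
        fix C assume C: "C \<in> ?S" "C \<subseteq> (\<Union>i. A i)"
        have "(\<lambda>i. \<mu> (C \<inter> A i)) sums \<mu> (\<Union>i. C \<inter> A i)"
          using A C by (intro signed_measure_sums[OF \<mu>]) (auto simp: disjoint_family_on_def)
        also have "(\<Union>i. C \<inter> A i) = C" using C by auto
        finally have "(\<lambda>n. ennreal (\<Sum>i<n. \<mu> (C \<inter> A i))) \<longlonglongrightarrow> ennreal (\<mu> C)"
          unfolding sums_def by (rule tendsto_ennrealI)
        moreover have "ennreal (\<Sum>i<n. \<mu> (C \<inter> A i)) \<le> (\<Sum>i. f (A i))" for n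
        proof -
          have "ennreal (\<Sum>i<n. \<mu> (C \<inter> A i)) \<le> (\<Sum>i<n. f (A i))"
          proof (induction n)
            case (Suc n)
            have "C \<inter> A n \<in> ?S" using A C by auto
            then have "ennreal (\<mu> (C \<inter> A n)) \<le> f (A n)" by (intro upper) auto
            then have "ennreal (\<Sum>i<n. \<mu> (C \<inter> A i)) + ennreal (\<mu> (C \<inter> A n)) \<le> (\<Sum>i<Suc n. f (A i))"
              using Suc by (simp add: add_mono)
            \<comment> \<open>Equality may fail for x and y of opposite signs because of the
              truncation, but the inequality points in the required direction.\<close>
            moreover have "ennreal (x + y) \<le> ennreal x + ennreal y" for x y
              unfolding ennreal_plus_if by (auto intro!: ennreal_leI)
            ultimately show ?case by (simp only: sum.lessThan_Suc) (rule order_trans)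
          qed simp
          also have "\<dots> \<le> (\<Sum>i. f (A i))" by (rule sum_le_suminf) auto
          finally show ?thesis .
        qed
        ultimately show "ennreal (\<mu> C) \<le> (\<Sum>i. f (A i))"
          by (intro LIMSEQ_le_const2) auto
      qed
    qed
  qed
  moreover have "sigma_algebra X ?S"
    using sets.sigma_algebra_axioms[of "borel_on X"] by (simp add: space_restrict_space)
  moreover have "positive ?S f" using f0 by (simp add: positive_def)
  ultimately have "emeasure (measure_of X ?S f) A = f A"
    using A by (intro emeasure_measure_of_sigma)
  then show ?thesis by (simp add: pos_variation_def f_def[abs_def])
qed

text \<open>If the positive part were infinite, one could split off, again and again, disjoint sets
  \<open>D n\<close> with \<open>\<bar>\<mu> (D n)\<bar> \<ge> 1\<close>, so that the series of the \<open>\<mu> (D n)\<close> would diverge.\<close>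

lemma finite_measure_pos_variation:
  assumes \<mu>: "\<mu> \<in> signed_measures X"
  shows "finite_measure (pos_variation X \<mu>)"
proof (rule finite_measureI, rule ccontr)
  let ?P = "emeasure (pos_variation X \<mu>)" and ?S = "sets (borel_on X)"
  assume "\<not> ?P (space (pos_variation X \<mu>)) \<noteq> \<infinity>"
  then have X: "X \<in> ?S" "?P X = \<infinity>"
    using sets.top[of "borel_on X"] by (auto simp: space_restrict_space)
  have step: "\<exists>C. (C \<in> ?S \<and> ?P C = \<infinity>) \<and> C \<subseteq> A \<and> \<bar>\<mu> (A - C)\<bar> \<ge> 1"
    if A: "A \<in> ?S \<and> ?P A = \<infinity>" for A
  proof -
    \<comment> \<open>The margin \<open>1 + \<bar>\<mu> A\<bar>\<close> gives both \<open>B\<close>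
      and \<open>A - B\<close> a value of modulus at least 1. Whichever of the two has infinite
      variation is kept, and the other is split off.\<close>
    have "ennreal (1 + \<bar>\<mu> A\<bar>) < ?P A" using A by (simp del: ennreal_plus)
    then have "ennreal (1 + \<bar>\<mu> A\<bar>) < (SUP B\<in>{B \<in> ?S. B \<subseteq> A}. ennreal (\<mu> B))"
      using A emeasure_pos_variation[OF \<mu>, of A] by simp
    then obtain B where B: "B \<in> ?S" "B \<subseteq> A" "ennreal (1 + \<bar>\<mu> A\<bar>) < ennreal (\<mu> B)"
      unfolding less_SUP_iff by blast
    then have large: "\<mu> B > 1 + \<bar>\<mu> A\<bar>" by (simp add: ennreal_less_iff del: ennreal_plus)
    have diff: "\<mu> (A - B) = \<mu> A - \<mu> B" using A B signed_measure_Diff[OF \<mu>] by blast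
    have "B \<union> (A - B) = A" using B by auto
    moreover have "?P B + ?P (A - B) = ?P (B \<union> (A - B))"
      using A B by (intro plus_emeasure) auto
    ultimately have "?P B + ?P (A - B) = \<infinity>" using A by metis
    then consider "?P B = \<infinity>" | "?P (A - B) = \<infinity>" by auto
    then show ?thesis
    proof cases
      case 1
      then show ?thesis using B large diff by (intro exI[of _ B]) auto
    next
      case 2
      have "A - (A - B) = B" using B by auto
      then show ?thesis using A B large 2 by (intro exI[of _ "A - B"]) auto
    qed
  qed
  obtain E where E: "\<And>n. E n \<in> ?S \<and> ?P (E n) = \<infinity>"
    and sub: "\<And>n. E (Suc n) \<subseteq> E n" and big: "\<And>n. \<bar>\<mu> (E n - E (Suc n))\<bar> \<ge> 1"
    using dependent_nat_choice[of "\<lambda>_ A. A \<in> ?S \<and> ?P A = \<infinity>"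
        "\<lambda>_ A C. C \<subseteq> A \<and> \<bar>\<mu> (A - C)\<bar> \<ge> 1"] X step by metis
  have dec: "E n \<subseteq> E m" if "m \<le> n" for m n
    using lift_Suc_antimono_le[of E, OF sub that] .
  have "disjoint_family (\<lambda>n. E n - E (Suc n))"
    unfolding disjoint_family_on_def
  proof (intro ballI impI)
    fix m n :: nat assume "m \<noteq> n"
    then consider "Suc m \<le> n" | "Suc n \<le> m" by linarith
    then show "(E m - E (Suc m)) \<inter> (E n - E (Suc n)) = {}"
      using dec by cases blast+
  qed
  then have "(\<lambda>n. \<mu> (E n - E (Suc n))) sums \<mu> (\<Union>n. E n - E (Suc n))"
    using E by (intro signed_measure_sums[OF \<mu>]) auto
  then have "(\<lambda>n. \<mu> (E n - E (Suc n))) \<longlonglongrightarrow> 0"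
    by (intro summable_LIMSEQ_zero) (rule sums_summable)
  then have "eventually (\<lambda>n. \<bar>\<mu> (E n - E (Suc n))\<bar> < 1) sequentially"
    by (auto dest!: tendstoD[of _ _ _ 1])
  then show False using big by (auto simp: eventually_sequentially not_less[symmetric])
qed

lemma finite_measure_neg_variation:
  "\<mu> \<in> signed_measures X \<Longrightarrow> finite_measure (neg_variation X \<mu>)"
  unfolding neg_variation_def by (intro finite_measure_pos_variation signed_measures_uminus)

lemma signed_measure_le_pos_variation:
  assumes "\<mu> \<in> signed_measures X" "A \<in> sets (borel_on X)" "B \<in> sets (borel_on X)" "B \<subseteq> A"
  shows "\<mu> B \<le> measure (pos_variation X \<mu>) A"
proof -
  have "ennreal (\<mu> B) \<le> emeasure (pos_variation X \<mu>) A"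
    using assms by (auto simp: emeasure_pos_variation intro!: SUP_upper)
  then show ?thesis
    using finite_measure_pos_variation[OF assms(1)]
    by (simp add: finite_measure.emeasure_eq_measure)
qed

lemma measure_pos_variation_le:
  assumes "\<mu> \<in> signed_measures X" "A \<in> sets (borel_on X)"
    and le: "\<And>B. B \<in> sets (borel_on X) \<Longrightarrow> B \<subseteq> A \<Longrightarrow> \<mu> B \<le> c"
  shows "measure (pos_variation X \<mu>) A \<le> c"
proof -
  have "0 \<le> c" using le[of "{}"] signed_measure_empty[OF assms(1)] by simp
  have "emeasure (pos_variation X \<mu>) A \<le> ennreal c"
    using assms by (auto simp: emeasure_pos_variation intro!: SUP_least ennreal_leI)
  with \<open>0 \<le> c\<close> show ?thesis
    using finite_measure_pos_variation[OF assms(1)]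
    by (simp add: finite_measure.emeasure_eq_measure)
qed

text \<open>Complementation in \<open>A\<close> exchanges the competitors for the two variations:
  \<open>\<mu> B = \<mu> A - \<mu> (A - B)\<close>, where \<open>- \<mu> (A - B)\<close> is at most
  the negative variation of \<open>A\<close>. Taking the supremum over \<open>B\<close> gives one
  inequality, and the same argument for \<open>- \<mu>\<close> the other.\<close>

lemma Jordan_decomposition:
  assumes \<mu>: "\<mu> \<in> signed_measures X" and A: "A \<in> sets (borel_on X)"
  shows "\<mu> A = measure (pos_variation X \<mu>) A - measure (neg_variation X \<mu>) A"
proof (rule antisym)
  note \<mu>' = signed_measures_uminus[OF \<mu>]
  have "measure (neg_variation X \<mu>) A \<le> measure (pos_variation X \<mu>) A - \<mu> A"
    unfolding neg_variation_def
  proof (rule measure_pos_variation_le[OF \<mu>' A])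
    fix B assume B: "B \<in> sets (borel_on X)" "B \<subseteq> A"
    then show "- \<mu> B \<le> measure (pos_variation X \<mu>) A - \<mu> A"
      using signed_measure_le_pos_variation[OF \<mu> A, of "A - B"] signed_measure_Diff[OF \<mu> A] A by auto
  qed
  then show "\<mu> A \<le> measure (pos_variation X \<mu>) A - measure (neg_variation X \<mu>) A" by simp
  have "measure (pos_variation X \<mu>) A \<le> measure (neg_variation X \<mu>) A + \<mu> A"
  proof (rule measure_pos_variation_le[OF \<mu> A])
    fix B assume B: "B \<in> sets (borel_on X)" "B \<subseteq> A"
    then show "\<mu> B \<le> measure (neg_variation X \<mu>) A + \<mu> A"
      unfolding neg_variation_def
      using signed_measure_le_pos_variation[OF \<mu>' A, of "A - B"] signed_measure_Diff[OF \<mu> A] A by auto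
  qed
  then show "measure (pos_variation X \<mu>) A - measure (neg_variation X \<mu>) A \<le> \<mu> A" by simp
qed

section \<open>Signed integrals\<close>

lemma integrable_bounded_on:
  fixes f :: "'a \<Rightarrow> real"
  assumes "finite_measure P" "f \<in> borel_measurable P" "\<And>x. x \<in> space P \<Longrightarrow> \<bar>f x\<bar> \<le> B"
  shows "integrable P f"
  using assms by (intro finite_measure.integrable_const_bound[of _ _ B]) auto

text \<open>The source of linearity in the measure. Jordan parts do not depend linearly on the
  signed measure, but a linear relation among finite measures does pass to integrals, by induction
  from indicators to nonnegative measurable functions.\<close>

lemma sum_integral_eq_0_nonneg:
  fixes f :: "'a \<Rightarrow> real" and c :: "'i \<Rightarrow> real"
  assumes fin: "\<And>i. i \<in> I \<Longrightarrow> finite_measure (P i)"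
    and sets: "\<And>i. i \<in> I \<Longrightarrow> sets (P i) = sets M"
    and zero: "\<And>A. A \<in> sets M \<Longrightarrow> (\<Sum>i\<in>I. c i * measure (P i) A) = 0"
    and f: "f \<in> borel_measurable M" "\<And>x. 0 \<le> f x" "\<And>x. x \<in> space M \<Longrightarrow> f x \<le> B"
  shows "(\<Sum>i\<in>I. c i * (LINT x|P i. f x)) = 0"
proof -
  have meas: "g \<in> borel_measurable (P i) \<longleftrightarrow> g \<in> borel_measurable M"
    if "i \<in> I" for i and g :: "'a \<Rightarrow> real"
    by (simp add: measurable_cong_sets[OF sets[OF that] refl])
  have space: "space (P i) = space M" if "i \<in> I" for i
    using sets_eq_imp_space_eq[OF sets[OF that]] .
  have int: "integrable (P i) g"
    if "i \<in> I" "g \<in> borel_measurable M" "\<And>x. 0 \<le> g x" "\<And>x. x \<in> space M \<Longrightarrow> g x \<le> b" for i g and b :: real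
    using that by (intro integrable_bounded_on[of _ _ b] fin) (auto simp: meas space)
  \<comment> \<open>\<open>B\<close> is generalised because the case of a multiple
    \<open>k * u\<close> calls the induction hypothesis with the bound \<open>B / k\<close>.\<close>
  have "(\<forall>x\<in>space M. f x \<le> B) \<Longrightarrow> (\<Sum>i\<in>I. c i * (LINT x|P i. f x)) = 0" for B
    using f(1,2)
  proof (induction f arbitrary: B rule: borel_measurable_induct_real)
    case (set A)
    have "(LINT x|P i. indicator A x) = measure (P i) A" if "i \<in> I" for i
      using set sets.sets_into_space[of A "P i"] sets[OF that] space[OF that]
      by (simp add: Int_absorb2)
    then show ?case using zero[OF set(1)] by simp
  next
    case (mult u k)
    show ?case
    proof (cases "k = 0")
      case False
      with mult have "k > 0" by simp
      with mult have "\<forall>x\<in>space M. u x \<le> B / k" by (simp add: field_simps)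
      from mult.IH[OF this] have "k * (\<Sum>i\<in>I. c i * (LINT x|P i. u x)) = 0" by simp
      then show ?thesis by (simp add: sum_distrib_left ac_simps)
    qed simp
  next
    case (add u v)
    have le: "\<forall>x\<in>space M. u x \<le> B" "\<forall>x\<in>space M. v x \<le> B"
      using add.prems add.hyps(2,4) by (metis add_increasing add_increasing2 order_refl order_trans)+
    have "(LINT x|P i. v x + u x) = (LINT x|P i. v x) + (LINT x|P i. u x)" if "i \<in> I" for i
      using add le by (intro Bochner_Integration.integral_add int[OF that, where b=B]) auto
    then show ?case
      using add.IH le by (simp add: distrib_left sum.distrib)
  next
    case (seq U)
    have le: "U n x \<le> f x" if "x \<in> space M" for n x
      using seq.hyps(4)[OF that] seq.hyps(3)
      by (intro incseq_le) (auto simp: incseq_def le_fun_def)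
    then have leB: "U n x \<le> B" if "x \<in> space M" for n x
      using seq.prems that order_trans by blast
    have [measurable]: "f \<in> borel_measurable M"
      using seq.hyps(1,4) by (rule borel_measurable_LIMSEQ_real[rotated])
    have "(\<lambda>n. \<Sum>i\<in>I. c i * (LINT x|P i. U n x)) \<longlonglongrightarrow> (\<Sum>i\<in>I. c i * (LINT x|P i. f x))"
    proof (intro tendsto_intros)
      fix i assume i: "i \<in> I"
      show "(\<lambda>n. LINT x|P i. U n x) \<longlonglongrightarrow> (LINT x|P i. f x)"
      proof (rule integral_dominated_convergence[where w="\<lambda>_. B"])
        show "integrable (P i) (\<lambda>_. B)"
          using fin[OF i] by (simp add: finite_measure.integrable_const)
      qed (use seq leB i in \<open>auto simp: meas space\<close>)
    qed
    moreover have "(\<Sum>i\<in>I. c i * (LINT x|P i. U n x)) = 0" for n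
      using seq.IH leB by blast
    ultimately show ?case by (simp add: LIMSEQ_const_iff)
  qed
  then show ?thesis using f(3) by blast
qed

lemma sum_integral_eq_0:
  fixes f :: "'a \<Rightarrow> real" and c :: "'i \<Rightarrow> real"
  assumes fin: "\<And>i. i \<in> I \<Longrightarrow> finite_measure (P i)"
    and sets: "\<And>i. i \<in> I \<Longrightarrow> sets (P i) = sets M"
    and zero: "\<And>A. A \<in> sets M \<Longrightarrow> (\<Sum>i\<in>I. c i * measure (P i) A) = 0"
    and f: "f \<in> borel_measurable M" "\<And>x. x \<in> space M \<Longrightarrow> \<bar>f x\<bar> \<le> B"
  shows "(\<Sum>i\<in>I. c i * (LINT x|P i. f x)) = 0"
proof -
  let ?p = "\<lambda>x. max 0 (f x)" and ?n = "\<lambda>x. max 0 (- f x)"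
  have B: "?p x \<le> B" "?n x \<le> B" if "x \<in> space M" for x using f(2)[OF that] by auto
  have "(LINT x|P i. f x) = (LINT x|P i. ?p x) - (LINT x|P i. ?n x)" if i: "i \<in> I" for i
  proof -
    have m: "f \<in> borel_measurable (P i)"
      using f(1) by (simp add: measurable_cong_sets[OF sets[OF i] refl])
    have space: "space (P i) = space M" by (rule sets_eq_imp_space_eq[OF sets[OF i]])
    have "integrable (P i) ?p" "integrable (P i) ?n"
      using m B space by (auto intro!: integrable_bounded_on[OF fin[OF i], of _ B])
    then have "(LINT x|P i. ?p x) - (LINT x|P i. ?n x) = (LINT x|P i. ?p x - ?n x)" by simp
    also have "(\<lambda>x. ?p x - ?n x) = f" by (auto simp: fun_eq_iff)
    finally show ?thesis by simp
  qed
  then have "(\<Sum>i\<in>I. c i * (LINT x|P i. f x)) =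
      (\<Sum>i\<in>I. c i * (LINT x|P i. ?p x)) - (\<Sum>i\<in>I. c i * (LINT x|P i. ?n x))"
    by (simp add: right_diff_distrib sum_subtractf)
  also have "(\<Sum>i\<in>I. c i * (LINT x|P i. ?p x)) = 0"
    by (rule sum_integral_eq_0_nonneg[where B = B, OF fin sets zero]) (use f B in auto)
  also have "(\<Sum>i\<in>I. c i * (LINT x|P i. ?n x)) = 0"
    by (rule sum_integral_eq_0_nonneg[where B = B, OF fin sets zero]) (use f B in auto)
  finally show ?thesis by simp
qed

section \<open>Total variation and linearity of the signed integral\<close>

definition total_variation :: "'a::topological_space set \<Rightarrow> ('a set \<Rightarrow> real) \<Rightarrow> real" where
  "total_variation X \<mu> = measure (pos_variation X \<mu>) X + measure (neg_variation X \<mu>) X"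

lemma total_variation_nonneg: "0 \<le> total_variation X \<mu>"
  by (simp add: total_variation_def)

lemma borel_measurable_variation:
  "f \<in> borel_measurable (pos_variation X \<mu>) \<longleftrightarrow> f \<in> borel_measurable (borel_on X)"
  "f \<in> borel_measurable (neg_variation X \<mu>) \<longleftrightarrow> f \<in> borel_measurable (borel_on X)"
  by (simp_all add: measurable_cong_sets[OF sets_pos_variation refl]
      measurable_cong_sets[OF sets_neg_variation refl])

lemma integrable_variation:
  fixes f :: "'a::topological_space \<Rightarrow> real"
  assumes "\<mu> \<in> signed_measures X" "f \<in> borel_measurable (borel_on X)" "\<And>x. x \<in> X \<Longrightarrow> \<bar>f x\<bar> \<le> B"
  shows "integrable (pos_variation X \<mu>) f" "integrable (neg_variation X \<mu>) f"
  using assms finite_measure_pos_variation finite_measure_neg_variation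
  by (auto intro!: integrable_bounded_on[of _ _ B] simp: borel_measurable_variation)

lemma signed_integral_cong:
  assumes "\<And>x. x \<in> X \<Longrightarrow> f x = g x"
  shows "signed_integral X \<mu> f = signed_integral X \<mu> g"
  unfolding signed_integral_def
  using assms by (intro arg_cong2[where f="(-)"] Bochner_Integration.integral_cong) auto

lemma signed_integral_lincomb:
  fixes f g :: "'a::topological_space \<Rightarrow> real"
  assumes \<mu>: "\<mu> \<in> signed_measures X"
    and f: "f \<in> borel_measurable (borel_on X)" "\<And>x. x \<in> X \<Longrightarrow> \<bar>f x\<bar> \<le> B"
    and g: "g \<in> borel_measurable (borel_on X)" "\<And>x. x \<in> X \<Longrightarrow> \<bar>g x\<bar> \<le> C"
  shows "signed_integral X \<mu> (\<lambda>x. a * f x + b * g x) =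
    a * signed_integral X \<mu> f + b * signed_integral X \<mu> g"
  using integrable_variation[OF \<mu> f] integrable_variation[OF \<mu> g]
  by (simp add: signed_integral_def algebra_simps)

text \<open>The Jordan decompositions of \<mu>, \<nu> and their combination \<rho> turn the
  definition of \<rho> into one linear relation between six finite measures, to which
  \<open>sum_integral_eq_0\<close> applies; the lists hold these measures and their
  coefficients.\<close>

lemma signed_integral_lincomb_measure:
  fixes f :: "'a::topological_space \<Rightarrow> real"
  assumes \<mu>: "\<mu> \<in> signed_measures X" and \<nu>: "\<nu> \<in> signed_measures X"
    and f: "f \<in> borel_measurable (borel_on X)" "\<And>x. x \<in> X \<Longrightarrow> \<bar>f x\<bar> \<le> B"
  shows "signed_integral X (\<lambda>A. a * \<mu> A + b * \<nu> A) f =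
    a * signed_integral X \<mu> f + b * signed_integral X \<nu> f"
proof -
  define \<rho> where "\<rho> = (\<lambda>A. a * \<mu> A + b * \<nu> A)"
  have \<rho>: "\<rho> \<in> signed_measures X" unfolding \<rho>_def by (rule signed_measures_lincomb[OF \<mu> \<nu>])
  let ?P = "[pos_variation X \<rho>, neg_variation X \<rho>, pos_variation X \<mu>, neg_variation X \<mu>,
    pos_variation X \<nu>, neg_variation X \<nu>]"
  let ?c = "[1, - 1, - a, a, - b, b]"
  have "(\<Sum>i<6. ?c ! i * (LINT x|(?P ! i). f x)) = 0"
  proof (rule sum_integral_eq_0[where M = "borel_on X" and B = B])
    fix A assume A: "A \<in> sets (borel_on X)"
    have "\<rho> A = a * \<mu> A + b * \<nu> A" by (simp add: \<rho>_def)
    then show "(\<Sum>i<6. ?c ! i * measure (?P ! i) A) = 0"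
      using Jordan_decomposition[OF \<rho> A] Jordan_decomposition[OF \<mu> A] Jordan_decomposition[OF \<nu> A]
      by (simp add: eval_nat_numeral algebra_simps)
  next
    fix i :: nat assume "i \<in> {..<6}"
    then have "i \<in> {0, 1, 2, 3, 4, 5}" by auto
    then show "finite_measure (?P ! i)" "sets (?P ! i) = sets (borel_on X)"
      using \<mu> \<nu> \<rho> by (auto simp: finite_measure_pos_variation finite_measure_neg_variation)
  qed (use f in \<open>auto simp: space_restrict_space\<close>)
  then show ?thesis
    unfolding \<rho>_def[symmetric] by (simp add: signed_integral_def eval_nat_numeral algebra_simps)
qed

text \<open>The same device with three measures: the positive variation minus the negative one minus
  \<open>Q\<close> vanishes on Borel sets, so the integrals agree without the Jordan parts being
  computed.\<close>

lemma signed_integral_measure: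
  fixes f :: "'a::topological_space \<Rightarrow> real"
  assumes Q: "finite_measure Q" "sets Q = sets (borel_on X)"
    and f: "f \<in> borel_measurable (borel_on X)" "\<And>x. x \<in> X \<Longrightarrow> \<bar>f x\<bar> \<le> B"
  shows "signed_integral X (measure Q) f = (LINT x|Q. f x)"
proof -
  have \<mu>: "measure Q \<in> signed_measures X" by (rule measure_in_signed_measures[OF Q])
  let ?P = "[pos_variation X (measure Q), neg_variation X (measure Q), Q]"
  let ?c = "[1, - 1, - 1 :: real]"
  have "(\<Sum>i<3. ?c ! i * (LINT x|(?P ! i). f x)) = 0"
  proof (rule sum_integral_eq_0[where M = "borel_on X" and B = B])
    fix A assume A: "A \<in> sets (borel_on X)"
    then show "(\<Sum>i<3. ?c ! i * measure (?P ! i) A) = 0"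
      using Jordan_decomposition[OF \<mu> A] by (simp add: eval_nat_numeral)
  next
    fix i :: nat assume "i \<in> {..<3}"
    then have "i \<in> {0, 1, 2}" by auto
    then show "finite_measure (?P ! i)" "sets (?P ! i) = sets (borel_on X)"
      using finite_measure_pos_variation[OF \<mu>] finite_measure_neg_variation[OF \<mu>] Q
      by (elim insertE emptyE; simp)+
  qed (use f in \<open>auto simp: space_restrict_space\<close>)
  then show ?thesis by (simp add: signed_integral_def eval_nat_numeral)
qed

section \<open>Step functions, bounds and Riemann sums\<close>

lemma signed_integral_indicator:
  assumes "\<mu> \<in> signed_measures X" "A \<in> sets (borel_on X)"
  shows "signed_integral X \<mu> (indicator A) = \<mu> A"
proof -
  have "A \<subseteq> X" using sets.sets_into_space[OF assms(2)] by (simp add: space_restrict_space)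
  then show ?thesis
    using Jordan_decomposition[OF assms] by (simp add: signed_integral_def Int_absorb2)
qed

lemma signed_integral_sum_indicator:
  fixes A :: "'i \<Rightarrow> 'a::topological_space set"
  assumes \<mu>: "\<mu> \<in> signed_measures X" and I: "finite I" "\<And>i. i \<in> I \<Longrightarrow> A i \<in> sets (borel_on X)"
  shows "signed_integral X \<mu> (\<lambda>x. \<Sum>i\<in>I. c i * indicator (A i) x) = (\<Sum>i\<in>I. c i * \<mu> (A i))"
  using I
proof (induction I rule: finite_induct)
  case (insert j I)
  have m: "(\<lambda>x. \<Sum>i\<in>I. c i * indicator (A i) x) \<in> borel_measurable (borel_on X)"
    by (intro borel_measurable_sum borel_measurable_times borel_measurable_indicator)
      (use insert.prems in auto)
  have b: "\<bar>\<Sum>i\<in>I. c i * indicator (A i) x\<bar> \<le> (\<Sum>i\<in>I. \<bar>c i\<bar>)" for x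
    by (rule order_trans[OF sum_abs]) (auto intro!: sum_mono simp: indicator_def)
  have "signed_integral X \<mu> (\<lambda>x. c j * indicator (A j) x + 1 * (\<Sum>i\<in>I. c i * indicator (A i) x)) =
      c j * signed_integral X \<mu> (indicator (A j)) +
      1 * signed_integral X \<mu> (\<lambda>x. \<Sum>i\<in>I. c i * indicator (A i) x)"
    using insert.prems m b
    by (intro signed_integral_lincomb[OF \<mu>, where B=1]) (auto simp: indicator_def)
  with insert show ?case by (simp add: signed_integral_indicator[OF \<mu>] del: sum_mult_indicator)
qed (simp add: signed_integral_def)

lemma abs_integral_le_measure:
  fixes f :: "'a \<Rightarrow> real"
  assumes "finite_measure P" "f \<in> borel_measurable P" "\<And>x. x \<in> space P \<Longrightarrow> \<bar>f x\<bar> \<le> B"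
  shows "\<bar>LINT x|P. f x\<bar> \<le> B * measure P (space P)"
proof -
  interpret finite_measure P by fact
  have "\<bar>LINT x|P. f x\<bar> \<le> (LINT x|P. \<bar>f x\<bar>)" by (rule integral_abs_bound)
  also have "\<dots> \<le> (LINT x|P. B)"
    using assms by (intro integral_mono integrable_abs integrable_bounded_on[of P f B]) auto
  finally show ?thesis by (simp add: mult.commute)
qed

lemma signed_integral_bound:
  fixes f :: "'a::topological_space \<Rightarrow> real"
  assumes \<mu>: "\<mu> \<in> signed_measures X"
    and f: "f \<in> borel_measurable (borel_on X)" "\<And>x. x \<in> X \<Longrightarrow> \<bar>f x\<bar> \<le> B"
  shows "\<bar>signed_integral X \<mu> f\<bar> \<le> B * total_variation X \<mu>"
  using abs_integral_le_measure[OF finite_measure_pos_variation[OF \<mu>], of f B]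
    abs_integral_le_measure[OF finite_measure_neg_variation[OF \<mu>], of f B] f
  by (auto simp: signed_integral_def total_variation_def borel_measurable_variation algebra_simps)

text \<open>The sum is the integral of the step function \<open>g\<close> with value
  \<open>c i\<close> on \<open>A i\<close>, and \<open>f - g\<close> is at most \<open>e\<close> in
  modulus on \<open>X\<close>. This is how a signed measure is replaced by point masses of weight
  \<open>\<mu> (A i)\<close>.\<close>

lemma signed_integral_riemann_sum:
  fixes f :: "'a::topological_space \<Rightarrow> real" and A :: "'i \<Rightarrow> 'a set"
  assumes \<mu>: "\<mu> \<in> signed_measures X"
    and f: "f \<in> borel_measurable (borel_on X)" "\<And>x. x \<in> X \<Longrightarrow> \<bar>f x\<bar> \<le> B"
    and I: "finite I" "\<And>i. i \<in> I \<Longrightarrow> A i \<in> sets (borel_on X)" "disjoint_family_on A I" "(\<Union>i\<in>I. A i) = X"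
    and le: "\<And>i x. i \<in> I \<Longrightarrow> x \<in> A i \<Longrightarrow> \<bar>f x - c i\<bar> \<le> e"
  shows "\<bar>signed_integral X \<mu> f - (\<Sum>i\<in>I. c i * \<mu> (A i))\<bar> \<le> e * total_variation X \<mu>"
proof -
  define g where "g x = (\<Sum>i\<in>I. c i * indicator (A i) x)" for x
  have gm: "g \<in> borel_measurable (borel_on X)"
    unfolding g_def
    by (intro borel_measurable_sum borel_measurable_times borel_measurable_indicator) (use I(2) in auto)
  have gb: "\<bar>g x\<bar> \<le> (\<Sum>i\<in>I. \<bar>c i\<bar>)" for x
    unfolding g_def by (rule order_trans[OF sum_abs]) (auto intro!: sum_mono simp: indicator_def)
  have geq: "g x = c i" if "i \<in> I" "x \<in> A i" for i x
  proof -
    have "indicator (A j) x = (if j = i then 1 else 0 :: real)" if "j \<in> I" for j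
      using disjoint_family_onD[OF I(3) that \<open>i \<in> I\<close>] \<open>x \<in> A i\<close> by (auto simp: indicator_def)
    then have "g x = (\<Sum>j\<in>I. if j = i then c j else 0)"
      unfolding g_def by (intro sum.cong) auto
    then show ?thesis using I(1) that by simp
  qed
  have "\<bar>signed_integral X \<mu> (\<lambda>x. 1 * f x + (- 1) * g x)\<bar> \<le> e * total_variation X \<mu>"
  proof (rule signed_integral_bound[OF \<mu>])
    fix x assume "x \<in> X"
    then obtain i where "i \<in> I" "x \<in> A i" using I(4) by auto
    then show "\<bar>1 * f x + (- 1) * g x\<bar> \<le> e" using le geq by simp
  qed (use f gm in auto)
  also have "signed_integral X \<mu> (\<lambda>x. 1 * f x + (- 1) * g x) =
      signed_integral X \<mu> f - signed_integral X \<mu> g"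
    using signed_integral_lincomb[OF \<mu> f gm gb, of 1 "-1"] by simp
  also have "signed_integral X \<mu> g = (\<Sum>i\<in>I. c i * \<mu> (A i))"
    unfolding g_def by (rule signed_integral_sum_indicator[OF \<mu> I(1,2)])
  finally show ?thesis .
qed

section \<open>Potentials and mutual energy\<close>

lemma compact_countable_dense:
  fixes X :: "'a::metric_space set"
  assumes "compact X"
  obtains D where "countable D" "D \<subseteq> X" "\<And>x e. x \<in> X \<Longrightarrow> e > 0 \<Longrightarrow> \<exists>d\<in>D. dist x d < e"
proof -
  have "seq_compact X" using assms by (simp add: compact_eq_seq_compact_metric)
  then have tb: "\<exists>k. finite k \<and> k \<subseteq> X \<and> X \<subseteq> (\<Union>x\<in>k. ball x e)" if "e > 0" for e
    using seq_compact_imp_totally_bounded[of X] that by blast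
  have "\<forall>n. \<exists>k. finite k \<and> k \<subseteq> X \<and> X \<subseteq> (\<Union>x\<in>k. ball x (inverse (real (Suc n))))"
    by (intro allI tb) simp
  from choice[OF this] obtain k where k: "\<And>n. finite (k n)" "\<And>n. k n \<subseteq> X"
    "\<And>n. X \<subseteq> (\<Union>x\<in>k n. ball x (inverse (real (Suc n))))"
    by blast
  show thesis
  proof (rule that[of "\<Union>n. k n"])
    fix x and e :: real assume "x \<in> X" "e > 0"
    then obtain n where n: "inverse (real (Suc n)) < e" using reals_Archimedean by blast
    obtain d where "d \<in> k n" "x \<in> ball d (inverse (real (Suc n)))" using k(3)[of n] \<open>x \<in> X\<close> by blast
    then have "d \<in> (\<Union>n. k n)" "dist x d < e" using n by (auto simp: dist_commute simp del: of_nat_Suc)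
    then show "\<exists>d\<in>\<Union>n. k n. dist x d < e" by (rule bexI[rotated])
  qed (use k in \<open>auto simp: countable_finite\<close>)
qed

lemma borel_measurable_continuous_borel_on:
  fixes f :: "'a::topological_space \<Rightarrow> real"
  assumes "continuous_on UNIV f"
  shows "f \<in> borel_measurable (borel_on X)"
  by (intro measurable_restrict_space1 borel_measurable_continuous_onI assms)

context
  fixes X :: "'a::metric_space set"
  assumes X: "compact X"
begin

lemma dist_le_diameter: "x \<in> X \<Longrightarrow> y \<in> X \<Longrightarrow> \<bar>dist x y\<bar> \<le> diameter X"
  using diameter_bounded_bound[OF compact_imp_bounded[OF X]] by simp

text \<open>Since \<open>'a\<close> need not be second countable, measurability with respect to the product of the
  Borel algebras requires the separability of \<open>X\<close>: the distance is the infimum of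
  \<open>dist x d + dist y d\<close> over \<open>d\<close> in a countable dense set.\<close>

lemma borel_measurable_dist_pair:
  "(\<lambda>p. dist (fst p) (snd p)) \<in> borel_measurable (borel_on X \<Otimes>\<^sub>M borel_on X)"
proof -
  obtain D where D: "countable D" "D \<subseteq> X" "\<And>x e. x \<in> X \<Longrightarrow> e > 0 \<Longrightarrow> \<exists>d\<in>D. dist x d < e"
    using compact_countable_dense[OF X] by blast
  have m: "(\<lambda>x. dist x d) \<in> borel_measurable (borel_on X)" for d
    by (intro borel_measurable_continuous_borel_on continuous_intros)
  have "(\<lambda>p. INF d\<in>D. dist (fst p) d + dist (snd p) d) \<in> borel_measurable (borel_on X \<Otimes>\<^sub>M borel_on X)"
    by (intro borel_measurable_cINF_real D(1) borel_measurable_add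
        measurable_compose[OF measurable_fst m] measurable_compose[OF measurable_snd m])
  moreover have "(INF d\<in>D. dist (fst p) d + dist (snd p) d) = dist (fst p) (snd p)"
    if "p \<in> space (borel_on X \<Otimes>\<^sub>M borel_on X)" for p
  proof -
    have p: "fst p \<in> X" "snd p \<in> X"
      using that by (auto simp: space_pair_measure space_restrict_space)
    have "D \<noteq> {}" using D(3)[OF p(1) zero_less_one] by auto
    show ?thesis
    proof (rule antisym)
      show "dist (fst p) (snd p) \<le> (INF d\<in>D. dist (fst p) d + dist (snd p) d)"
        by (intro cINF_greatest \<open>D \<noteq> {}\<close> dist_triangle2)
      show "(INF d\<in>D. dist (fst p) d + dist (snd p) d) \<le> dist (fst p) (snd p)"
      proof (rule field_le_epsilon)
        fix e :: real assume "e > 0"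
        \<comment> \<open>A point within \<open>e / 2\<close> of \<open>fst p\<close> costs at most
          \<open>e / 2\<close> twice: once directly and once through the triangle
          inequality.\<close>
        then obtain d where d: "d \<in> D" "dist (fst p) d < e / 2" using D(3)[OF p(1), of "e/2"] by auto
        have "(INF d\<in>D. dist (fst p) d + dist (snd p) d) \<le> dist (fst p) d + dist (snd p) d"
          using d(1) by (intro cINF_lower bdd_belowI[of _ 0]) auto
        also have "\<dots> \<le> dist (fst p) (snd p) + e"
          using d(2) dist_triangle3[of "snd p" d "fst p"] by (simp add: dist_commute)
        finally show "(INF d\<in>D. dist (fst p) d + dist (snd p) d) \<le> dist (fst p) (snd p) + e" .
      qed
    qed
  qed
  ultimately show ?thesis by (subst measurable_cong[symmetric]) auto
qed

lemma integral_dist_measurable: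
  assumes "finite_measure P" "sets P = sets (borel_on X)"
  shows "(\<lambda>y. LINT x|P. dist x y) \<in> borel_measurable (borel_on X)"
proof -
  interpret finite_measure P by fact
  have "(\<lambda>(y, x). dist x y) \<in> borel_measurable (borel_on X \<Otimes>\<^sub>M P)"
    using borel_measurable_dist_pair assms(2)
    by (simp add: measurable_cong_sets[OF sets_pair_measure_cong[OF refl assms(2)] refl]
        case_prod_unfold dist_commute)
  then show ?thesis by (rule borel_measurable_lebesgue_integral)
qed

lemma integral_dist_bound:
  assumes "finite_measure P" "sets P = sets (borel_on X)" "y \<in> X"
  shows "\<bar>LINT x|P. dist x y\<bar> \<le> diameter X * measure P X"
proof -
  have "space P = X" using sets_eq_imp_space_eq[OF assms(2)] by (simp add: space_restrict_space)
  moreover have "(\<lambda>x. dist x y) \<in> borel_measurable P"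
    by (simp add: measurable_cong_sets[OF assms(2) refl])
      (intro borel_measurable_continuous_borel_on continuous_intros)
  ultimately show ?thesis
    using abs_integral_le_measure[OF assms(1), of "\<lambda>x. dist x y" "diameter X"] dist_le_diameter assms(3)
    by auto
qed

text \<open>Fubini, combined with the symmetry of the distance, which restores the order of its
  arguments. Integrability holds because the distance is bounded by the diameter and the product
  measure is finite.\<close>

lemma integral_dist_swap:
  assumes P: "finite_measure P" "sets P = sets (borel_on X)"
    and Q: "finite_measure Q" "sets Q = sets (borel_on X)"
  shows "(LINT y|Q. LINT x|P. dist x y) = (LINT y|P. LINT x|Q. dist x y)"
proof -
  interpret P: finite_measure P by fact
  interpret Q: finite_measure Q by fact
  interpret pair_sigma_finite P Q ..
  have "space P = X" "space Q = X"
    using sets_eq_imp_space_eq[OF P(2)] sets_eq_imp_space_eq[OF Q(2)]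
    by (auto simp: space_restrict_space)
  moreover have "(\<lambda>(x, y). dist x y) \<in> borel_measurable (P \<Otimes>\<^sub>M Q)"
    using borel_measurable_dist_pair
    by (simp add: measurable_cong_sets[OF sets_pair_measure_cong[OF P(2) Q(2)] refl] case_prod_unfold)
  ultimately have "integrable (P \<Otimes>\<^sub>M Q) (\<lambda>(x, y). dist x y)"
    using dist_le_diameter finite_measure_pair_measure[OF Q(1) P(1)]
    by (intro integrable_bounded_on[of _ _ "diameter X"]) (auto simp: space_pair_measure)
  from Fubini_integral[OF this] show ?thesis by (simp add: dist_commute)
qed

section \<open>Bilinearity and symmetry of the mutual energy\<close>

lemma potential_altdef: "potential X \<mu> y = signed_integral X \<mu> (\<lambda>x. dist x y)"
  by (simp add: potential_def dist_commute)

lemma mutual_energy_potential: "mutual_energy X \<mu> \<nu> = signed_integral X \<nu> (potential X \<mu>)"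
  by (simp add: mutual_energy_def potential_altdef[abs_def])

lemma borel_measurable_dist: "(\<lambda>x. dist x y) \<in> borel_measurable (borel_on X)"
  by (intro borel_measurable_continuous_borel_on continuous_intros)

lemma potential_measurable:
  assumes "\<mu> \<in> signed_measures X"
  shows "potential X \<mu> \<in> borel_measurable (borel_on X)"
proof -
  have "potential X \<mu> = (\<lambda>y. (LINT x|pos_variation X \<mu>. dist x y) - (LINT x|neg_variation X \<mu>. dist x y))"
    by (simp add: fun_eq_iff potential_altdef signed_integral_def)
  moreover have "(\<lambda>y. LINT x|pos_variation X \<mu>. dist x y) \<in> borel_measurable (borel_on X)"
    by (rule integral_dist_measurable[OF finite_measure_pos_variation[OF assms] sets_pos_variation])
  moreover have "(\<lambda>y. LINT x|neg_variation X \<mu>. dist x y) \<in> borel_measurable (borel_on X)"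
    by (rule integral_dist_measurable[OF finite_measure_neg_variation[OF assms] sets_neg_variation])
  ultimately show ?thesis by (simp only: borel_measurable_diff)
qed

lemma potential_bound:
  assumes "\<mu> \<in> signed_measures X" "y \<in> X"
  shows "\<bar>potential X \<mu> y\<bar> \<le> diameter X * total_variation X \<mu>"
  unfolding potential_altdef
  using assms(2) by (intro signed_integral_bound[OF assms(1)] borel_measurable_dist dist_le_diameter)

text \<open>The inner integral is linear in the measure, which gives linearity of the potential
  pointwise on \<open>X\<close>; the outer integral is linear in the integrand.\<close>

lemma mutual_energy_lincomb_left:
  assumes \<mu>: "\<mu> \<in> signed_measures X" "\<mu>' \<in> signed_measures X" and \<nu>: "\<nu> \<in> signed_measures X"
  shows "mutual_energy X (\<lambda>A. a * \<mu> A + b * \<mu>' A) \<nu> =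
    a * mutual_energy X \<mu> \<nu> + b * mutual_energy X \<mu>' \<nu>"
proof -
  have "potential X (\<lambda>A. a * \<mu> A + b * \<mu>' A) y = a * potential X \<mu> y + b * potential X \<mu>' y"
    if "y \<in> X" for y
    unfolding potential_altdef
    using that by (intro signed_integral_lincomb_measure[OF \<mu>, where B = "diameter X"]
        borel_measurable_dist dist_le_diameter)
  then have "mutual_energy X (\<lambda>A. a * \<mu> A + b * \<mu>' A) \<nu> =
      signed_integral X \<nu> (\<lambda>y. a * potential X \<mu> y + b * potential X \<mu>' y)"
    unfolding mutual_energy_potential by (rule signed_integral_cong)
  also have "\<dots> = a * mutual_energy X \<mu> \<nu> + b * mutual_energy X \<mu>' \<nu>"
    unfolding mutual_energy_potential
    by (rule signed_integral_lincomb[OF \<nu> potential_measurable[OF \<mu>(1)] potential_bound[OF \<mu>(1)]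
          potential_measurable[OF \<mu>(2)] potential_bound[OF \<mu>(2)]])
  finally show ?thesis .
qed

text \<open>Both sides expand into four double integrals over pairs of Jordan parts, and Fubini
  matches them one by one.\<close>

lemma mutual_energy_commute:
  assumes \<mu>: "\<mu> \<in> signed_measures X" and \<nu>: "\<nu> \<in> signed_measures X"
  shows "mutual_energy X \<mu> \<nu> = mutual_energy X \<nu> \<mu>"
proof -
  note fin = finite_measure_pos_variation finite_measure_neg_variation
  have int: "integrable Q (\<lambda>y. LINT x|P. dist x y)"
    if "finite_measure P" "sets P = sets (borel_on X)" "finite_measure Q" "sets Q = sets (borel_on X)" for P Q
  proof (rule integrable_bounded_on[OF that(3)])
    show "(\<lambda>y. LINT x|P. dist x y) \<in> borel_measurable Q"
      using integral_dist_measurable[OF that(1,2)] by (simp add: measurable_cong_sets[OF that(4) refl])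
    show "\<bar>LINT x|P. dist x y\<bar> \<le> diameter X * measure P X" if "y \<in> space Q" for y
      using that integral_dist_bound[OF \<open>finite_measure P\<close> \<open>sets P = _\<close>]
        sets_eq_imp_space_eq[OF \<open>sets Q = _\<close>] by (simp add: space_restrict_space)
  qed
  have expand: "mutual_energy X \<mu> \<nu> =
      (LINT y|pos_variation X \<nu>. LINT x|pos_variation X \<mu>. dist x y)
      - (LINT y|pos_variation X \<nu>. LINT x|neg_variation X \<mu>. dist x y)
      - ((LINT y|neg_variation X \<nu>. LINT x|pos_variation X \<mu>. dist x y)
      - (LINT y|neg_variation X \<nu>. LINT x|neg_variation X \<mu>. dist x y))"
    if \<mu>: "\<mu> \<in> signed_measures X" and \<nu>: "\<nu> \<in> signed_measures X" for \<mu> \<nu>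
    unfolding mutual_energy_def signed_integral_def
    by (simp add: int fin[OF \<mu>] fin[OF \<nu>])
  show ?thesis
    unfolding expand[OF \<mu> \<nu>] expand[OF \<nu> \<mu>]
    using integral_dist_swap[of "pos_variation X \<mu>" "pos_variation X \<nu>"]
      integral_dist_swap[of "pos_variation X \<mu>" "neg_variation X \<nu>"]
      integral_dist_swap[of "neg_variation X \<mu>" "pos_variation X \<nu>"]
      integral_dist_swap[of "neg_variation X \<mu>" "neg_variation X \<nu>"]
    by (simp add: fin[OF \<mu>] fin[OF \<nu>])
qed

section \<open>Discretisation, and the sign of the energy on measures of mass 0\<close>

lemma potential_lipschitz:
  assumes \<mu>: "\<mu> \<in> signed_measures X"
    and yz: "y \<in> X" "z \<in> X"
  shows "\<bar>potential X \<mu> y - potential X \<mu> z\<bar> \<le> dist y z * total_variation X \<mu>"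
proof -
  have "\<bar>signed_integral X \<mu> (\<lambda>x. 1 * dist x y + (- 1) * dist x z)\<bar> \<le> dist y z * total_variation X \<mu>"
  proof (rule signed_integral_bound[OF \<mu>])
    show "\<bar>1 * dist x y + (- 1) * dist x z\<bar> \<le> dist y z" for x
      using abs_dist_diff_le[of y x z] by (simp add: dist_commute)
  qed (intro borel_measurable_continuous_borel_on continuous_intros)
  then show ?thesis
    using signed_integral_lincomb[OF \<mu> borel_measurable_dist dist_le_diameter borel_measurable_dist
        dist_le_diameter, of y z 1 "- 1"] yz
    by (simp add: potential_altdef)
qed

text \<open>Finitely many balls cover \<open>X\<close>, and removing the earlier balls from each
  makes the pieces disjoint. The centre \<open>p i\<close> may lie outside \<open>A i\<close>; only
  its distance to the points of \<open>A i\<close> matters. Indices start at 1 to match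
  \<open>quasihypermetric\<close>.\<close>

lemma fine_partition:
  assumes "e > 0"
  obtains n and p :: "nat \<Rightarrow> 'a" and A :: "nat \<Rightarrow> 'a set" where
    "\<forall>i\<in>{1..n}. p i \<in> X" "\<forall>i\<in>{1..n}. A i \<in> sets (borel_on X)"
    "disjoint_family_on A {1..n}" "(\<Union>i\<in>{1..n}. A i) = X"
    "\<forall>i\<in>{1..n}. \<forall>x\<in>A i. dist x (p i) < e"
proof -
  have "seq_compact X" using X by (simp add: compact_eq_seq_compact_metric)
  then obtain k where k: "finite k" "k \<subseteq> X" "X \<subseteq> (\<Union>x\<in>k. ball x e)"
    using seq_compact_imp_totally_bounded[of X] assms by blast
  obtain p where p: "bij_betw p {1..card k} k"
    using ex_bij_betw_nat_finite_1[OF k(1)] by blast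
  then have pk: "p ` {1..card k} = k" by (simp add: bij_betw_def)
  define A where "A i = X \<inter> (ball (p i) e - (\<Union>j\<in>{1..<i}. ball (p j) e))" for i
  show thesis
  proof (rule that[of "card k" p A])
    show "\<forall>i\<in>{1..card k}. p i \<in> X" using pk k(2) by (simp add: image_subset_iff[symmetric])
    show "\<forall>i\<in>{1..card k}. A i \<in> sets (borel_on X)"
      unfolding A_def sets_restrict_space by (intro ballI imageI sets.Diff sets.finite_UN) auto
    show "disjoint_family_on A {1..card k}"
      unfolding disjoint_family_on_def
    proof (intro ballI impI)
      fix i j assume "i \<in> {1..card k}" "j \<in> {1..card k}" "i \<noteq> j"
      then consider "i \<in> {1..<j}" | "j \<in> {1..<i}" by fastforce
      then show "A i \<inter> A j = {}" unfolding A_def by cases blast+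
    qed
    show "(\<Union>i\<in>{1..card k}. A i) = X"
    proof (intro antisym subsetI)
      fix x assume "x \<in> X"
      with k(3) obtain y where y: "y \<in> k" "x \<in> ball y e" by blast
      have "y \<in> p ` {1..card k}" using y(1) by (simp only: pk)
      with y(2) have "\<exists>i. i \<in> {1..card k} \<and> x \<in> ball (p i) e" by (auto simp only:)
      \<comment> \<open>The least index of a ball containing \<open>x\<close> identifies the piece
        containing \<open>x\<close>.\<close>
      then obtain i where i: "i \<in> {1..card k}" "x \<in> ball (p i) e"
        and min: "\<And>j. j < i \<Longrightarrow> \<not> (j \<in> {1..card k} \<and> x \<in> ball (p j) e)"
        using exists_least_iff[of "\<lambda>i. i \<in> {1..card k} \<and> x \<in> ball (p i) e"] by blast
      have "x \<notin> ball (p j) e" if "j \<in> {1..<i}" for j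
        using min[of j] that i(1) by auto
      then have "x \<in> A i" unfolding A_def using i(2) \<open>x \<in> X\<close> by blast
      with i(1) show "x \<in> (\<Union>i\<in>{1..card k}. A i)" by blast
    qed (auto simp: A_def)
    show "\<forall>i\<in>{1..card k}. \<forall>x\<in>A i. dist x (p i) < e"
      by (simp add: A_def dist_commute)
  qed
qed

text \<open>For \<mu> of mass 0 the first part makes the weights \<open>\<mu> (A i)\<close>
  admissible in \<open>quasihypermetric\<close>; the second keeps the discretisation error
  independent of the number of pieces.\<close>

lemma sum_partition:
  assumes \<mu>: "\<mu> \<in> signed_measures X"
    and A: "finite I" "\<And>i. i \<in> I \<Longrightarrow> A i \<in> sets (borel_on X)" "disjoint_family_on A I" "(\<Union>i\<in>I. A i) = X"
  shows "(\<Sum>i\<in>I. \<mu> (A i)) = \<mu> X" "(\<Sum>i\<in>I. \<bar>\<mu> (A i)\<bar>) \<le> total_variation X \<mu>"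
proof -
  have XX: "X \<in> sets (borel_on X)" using sets.top[of "borel_on X"] by (simp add: space_restrict_space)
  have sum: "measure P X = (\<Sum>i\<in>I. measure P (A i))" if "finite_measure P" "sets P = sets (borel_on X)" for P
    using finite_measure.finite_measure_finite_Union[OF that(1) A(1) _ A(3)] A(2,4) that(2) by auto
  note sums = sum[OF finite_measure_pos_variation[OF \<mu>] sets_pos_variation]
    sum[OF finite_measure_neg_variation[OF \<mu>] sets_neg_variation]
  have J: "\<mu> (A i) = measure (pos_variation X \<mu>) (A i) - measure (neg_variation X \<mu>) (A i)" if "i \<in> I" for i
    using Jordan_decomposition[OF \<mu> A(2)[OF that]] .
  show "(\<Sum>i\<in>I. \<mu> (A i)) = \<mu> X"
    unfolding Jordan_decomposition[OF \<mu> XX] sums sum_subtractf[symmetric] by (intro sum.cong J refl)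
  show "(\<Sum>i\<in>I. \<bar>\<mu> (A i)\<bar>) \<le> total_variation X \<mu>"
    unfolding total_variation_def sums sum.distrib[symmetric]
  proof (rule sum_mono)
    fix i assume "i \<in> I"
    show "\<bar>\<mu> (A i)\<bar> \<le> measure (pos_variation X \<mu>) (A i) + measure (neg_variation X \<mu>) (A i)"
      unfolding J[OF \<open>i \<in> I\<close>]
      using measure_nonneg[of "pos_variation X \<mu>" "A i"] measure_nonneg[of "neg_variation X \<mu>" "A i"]
      by linarith
  qed
qed

text \<open>With T the total variation, replacing each of the two integrations by a sum over a
  partition of fineness e costs at most \<open>e * T * T\<close>. The remaining double sum is
  nonpositive by hypothesis, so the energy is at most \<open>2 * e * T * T\<close>.\<close>

lemma energy_nonpos:
  assumes qh: "quasihypermetric X" and \<nu>: "\<nu> \<in> signed_measures_0 X"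
  shows "energy X \<nu> \<le> 0"
proof (rule field_le_epsilon)
  fix d :: real assume "d > 0"
  have \<nu>': "\<nu> \<in> signed_measures X" and \<nu>0: "\<nu> X = 0" using \<nu> by (auto simp: signed_measures_0_def)
  define T where "T = total_variation X \<nu>"
  have T: "T \<ge> 0" by (simp add: T_def total_variation_nonneg)
  \<comment> \<open>Chosen so that \<open>2 * e * T * T \<le> d\<close>; the summand 1 covers the
    case \<open>T = 0\<close>.\<close>
  define e where "e = d / (2 * T * T + 1)"
  have "2 * T * T + 1 > 0" using T by (simp add: add_nonneg_pos)
  then have e: "e > 0" "e * (2 * T * T + 1) = d" using \<open>d > 0\<close> by (auto simp: e_def)
  show "energy X \<nu> \<le> 0 + d"
  proof (rule fine_partition[OF e(1)])
    fix n :: nat and p :: "nat \<Rightarrow> 'a" and A :: "nat \<Rightarrow> 'a set"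
    assume pA: "\<forall>i\<in>{1..n}. p i \<in> X" "\<forall>i\<in>{1..n}. A i \<in> sets (borel_on X)"
      "disjoint_family_on A {1..n}" "(\<Union>i\<in>{1..n}. A i) = X" "\<forall>i\<in>{1..n}. \<forall>x\<in>A i. dist x (p i) < e"
    note p = bspec[OF pA(1)] and A = bspec[OF pA(2)] pA(3,4) and near = bspec[OF bspec[OF pA(5)]]
    have AX: "x \<in> X" if "i \<in> {1..n}" "x \<in> A i" for i x using that A(3) by blast
    define a where "a i = \<nu> (A i)" for i
    have "(\<Sum>i=1..n. a i) = 0" and abs_a: "(\<Sum>i=1..n. \<bar>a i\<bar>) \<le> T"
      using sum_partition[OF \<nu>' _ A] \<nu>0 by (auto simp: a_def T_def)
    then have neg: "(\<Sum>i=1..n. \<Sum>j=1..n. a i * a j * dist (p i) (p j)) \<le> 0"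
      using qh p by (auto simp: quasihypermetric_def)
    \<comment> \<open>Outer integration: the potential has Lipschitz constant \<open>T\<close>, so
      it varies from its value at \<open>p i\<close> by at most \<open>e * T\<close> on
      \<open>A i\<close>.\<close>
    have 1: "\<bar>energy X \<nu> - (\<Sum>i=1..n. potential X \<nu> (p i) * a i)\<bar> \<le> (e * T) * T"
      unfolding energy_def mutual_energy_potential a_def T_def
    proof (rule signed_integral_riemann_sum[OF \<nu>' potential_measurable[OF \<nu>'] potential_bound[OF \<nu>'] _ A])
      fix i x assume i: "i \<in> {1..n}" "x \<in> A i"
      have "\<bar>potential X \<nu> x - potential X \<nu> (p i)\<bar> \<le> dist x (p i) * total_variation X \<nu>"
        using potential_lipschitz[OF \<nu>'] AX[OF i] p[OF i(1)] by blast
      also have "\<dots> \<le> e * total_variation X \<nu>"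
        using near[OF i] by (intro mult_right_mono total_variation_nonneg) auto
      finally show "\<bar>potential X \<nu> x - potential X \<nu> (p i)\<bar> \<le> e * total_variation X \<nu>" .
    qed simp_all
    \<comment> \<open>Inner integration: the distance to a fixed point is 1-Lipschitz, so the error
      at each \<open>p i\<close> is \<open>e * T\<close>; weighting by the \<open>a i\<close>
      contributes another factor \<open>T\<close>.\<close>
    have 2: "\<bar>potential X \<nu> (p i) - (\<Sum>j=1..n. dist (p j) (p i) * a j)\<bar> \<le> e * T" if i: "i \<in> {1..n}" for i
      unfolding potential_altdef a_def T_def
    proof (rule signed_integral_riemann_sum[OF \<nu>' borel_measurable_dist dist_le_diameter _ A])
      fix j x assume j: "j \<in> {1..n}" "x \<in> A j"
      show "\<bar>dist x (p i) - dist (p j) (p i)\<bar> \<le> e"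
        using abs_dist_diff_le[of x "p i" "p j"] near[OF j] by (simp add: dist_commute)
    qed (use p i in auto)
    have "(\<Sum>i=1..n. potential X \<nu> (p i) * a i) - (\<Sum>i=1..n. (\<Sum>j=1..n. dist (p j) (p i) * a j) * a i)
        = (\<Sum>i=1..n. (potential X \<nu> (p i) - (\<Sum>j=1..n. dist (p j) (p i) * a j)) * a i)"
      by (simp add: left_diff_distrib sum_subtractf)
    also have "\<dots> \<le> (\<Sum>i=1..n. e * T * \<bar>a i\<bar>)"
    proof (rule sum_mono)
      fix i assume "i \<in> {1..n}"
      have "(potential X \<nu> (p i) - (\<Sum>j=1..n. dist (p j) (p i) * a j)) * a i \<le>
          \<bar>potential X \<nu> (p i) - (\<Sum>j=1..n. dist (p j) (p i) * a j)\<bar> * \<bar>a i\<bar>"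
        by (metis abs_ge_self abs_mult)
      also have "\<dots> \<le> e * T * \<bar>a i\<bar>"
        using 2[OF \<open>i \<in> {1..n}\<close>] by (intro mult_right_mono) auto
      finally show "(potential X \<nu> (p i) - (\<Sum>j=1..n. dist (p j) (p i) * a j)) * a i \<le> e * T * \<bar>a i\<bar>" .
    qed
    also have "\<dots> = e * T * (\<Sum>i=1..n. \<bar>a i\<bar>)" by (simp add: sum_distrib_left)
    also have "\<dots> \<le> e * T * T" using e T abs_a by (intro mult_left_mono) auto
    finally have "(\<Sum>i=1..n. potential X \<nu> (p i) * a i)
        \<le> (\<Sum>i=1..n. (\<Sum>j=1..n. dist (p j) (p i) * a j) * a i) + e * T * T" by simp
    also have "(\<Sum>i=1..n. (\<Sum>j=1..n. dist (p j) (p i) * a j) * a i) =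
        (\<Sum>i=1..n. \<Sum>j=1..n. a i * a j * dist (p i) (p j))"
      by (simp add: sum_distrib_right sum_distrib_left dist_commute mult_ac)
    finally have "(\<Sum>i=1..n. potential X \<nu> (p i) * a i) \<le> e * T * T" using neg by simp
    with 1 have "energy X \<nu> \<le> e * (2 * T * T)" by (simp add: algebra_simps)
    also have "\<dots> \<le> 0 + d" using e by (simp add: algebra_simps)
    finally show ?thesis .
  qed
qed

section \<open>Point masses and probability measures\<close>

text \<open>Values of potentials are mutual energies with point masses, which links (5) to (4). The
  point mass is the push-forward of counting measure on a singleton, so its integrals follow from
  \<open>integral_distr\<close>.\<close>

lemma dirac_measure:
  assumes x: "x \<in> X"
  shows "\<exists>\<delta>\<in>prob_measures X. \<forall>\<nu>\<in>signed_measures X. mutual_energy X \<delta> \<nu> = potential X \<nu> x"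
proof (intro bexI ballI)
  define Q where "Q = distr (count_space {()}) (borel_on X) (\<lambda>_. x)"
  have m: "(\<lambda>_. x) \<in> count_space {()} \<rightarrow>\<^sub>M borel_on X"
    using x by (simp add: space_restrict_space)
  have "finite_measure (count_space {()})" by (rule finite_measure_count_space) simp
  then have Q: "finite_measure Q" "sets Q = sets (borel_on X)"
    unfolding Q_def using finite_measure.finite_measure_distr[OF _ m] by auto
  have "X \<in> sets (borel_on X)" using sets.top[of "borel_on X"] by (simp add: space_restrict_space)
  then have "measure Q X = 1"
    unfolding Q_def using x by (simp add: measure_distr[OF m] vimage_def)
  then show "measure Q \<in> prob_measures X"
    using measure_in_signed_measures[OF Q] by (simp add: prob_measures_def signed_measures_1_def)
  fix \<nu> assume \<nu>: "\<nu> \<in> signed_measures X"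
  \<comment> \<open>After the swap the point mass is the outer measure and merely evaluates the
    potential of \<nu>.\<close>
  have "mutual_energy X (measure Q) \<nu> = mutual_energy X \<nu> (measure Q)"
    by (rule mutual_energy_commute[OF measure_in_signed_measures[OF Q] \<nu>])
  also have "\<dots> = signed_integral X (measure Q) (potential X \<nu>)"
    by (rule mutual_energy_potential)
  also have "\<dots> = (LINT x|Q. potential X \<nu> x)"
    by (rule signed_integral_measure[OF Q potential_measurable[OF \<nu>] potential_bound[OF \<nu>]])
  also have "\<dots> = potential X \<nu> x"
    unfolding Q_def by (simp add: integral_distr[OF m potential_measurable[OF \<nu>]] lebesgue_integral_count_space_finite)
  finally show "mutual_energy X (measure Q) \<nu> = potential X \<nu> x" .
qed

text \<open>The negative variation of a nonnegative \<mu> has mass 0, so integration against \<mu>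
  preserves nonnegativity; this is applied to the distance and then to the potential.\<close>

lemma energy_prob_nonneg:
  assumes "\<mu> \<in> prob_measures X"
  shows "0 \<le> energy X \<mu>"
proof -
  have \<mu>: "\<mu> \<in> signed_measures X" and pos: "\<And>A. A \<in> sets (borel_on X) \<Longrightarrow> 0 \<le> \<mu> A"
    using assms by (auto simp: prob_measures_def signed_measures_1_def)
  have "X \<in> sets (borel_on X)" using sets.top[of "borel_on X"] by (simp add: space_restrict_space)
  then have "measure (neg_variation X \<mu>) X \<le> 0"
    unfolding neg_variation_def using pos
    by (intro measure_pos_variation_le signed_measures_uminus[OF \<mu>]) auto
  then have N: "measure (neg_variation X \<mu>) X = 0" by (simp add: antisym)
  have nonneg: "0 \<le> signed_integral X \<mu> f"
    if f: "f \<in> borel_measurable (borel_on X)" "\<And>x. x \<in> X \<Longrightarrow> \<bar>f x\<bar> \<le> B" "\<And>x. x \<in> X \<Longrightarrow> 0 \<le> f x" for f B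
  proof -
    have "\<bar>LINT x|neg_variation X \<mu>. f x\<bar> \<le> B * measure (neg_variation X \<mu>) (space (neg_variation X \<mu>))"
      using f by (intro abs_integral_le_measure finite_measure_neg_variation[OF \<mu>])
        (simp_all add: borel_measurable_variation)
    then have "(LINT x|neg_variation X \<mu>. f x) = 0" using N by simp
    moreover have "0 \<le> (LINT x|pos_variation X \<mu>. f x)"
      using f(3) by (intro Bochner_Integration.integral_nonneg) simp
    ultimately show ?thesis by (simp add: signed_integral_def)
  qed
  have "0 \<le> potential X \<mu> y" if "y \<in> X" for y
    unfolding potential_altdef
    using that by (intro nonneg[OF borel_measurable_dist dist_le_diameter]) auto
  then show ?thesis
    unfolding energy_def mutual_energy_potential
    by (intro nonneg[OF potential_measurable[OF \<mu>] potential_bound[OF \<mu>]])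
qed

section \<open>The quadratic expansion of the energy\<close>

lemma mutual_energy_lincomb_right:
  assumes "\<mu> \<in> signed_measures X" and "\<nu> \<in> signed_measures X" "\<nu>' \<in> signed_measures X"
  shows "mutual_energy X \<mu> (\<lambda>A. a * \<nu> A + b * \<nu>' A) =
    a * mutual_energy X \<mu> \<nu> + b * mutual_energy X \<mu> \<nu>'"
  unfolding mutual_energy_commute[OF assms(1,2)] mutual_energy_commute[OF assms(1,3)]
    mutual_energy_commute[OF assms(1) signed_measures_lincomb[OF assms(2,3)]]
  by (rule mutual_energy_lincomb_left[OF assms(2,3,1)])

lemma energy_lincomb:
  assumes "\<mu> \<in> signed_measures X" "\<nu> \<in> signed_measures X"
  shows "energy X (\<lambda>A. a * \<mu> A + b * \<nu> A) =
    a\<^sup>2 * energy X \<mu> + 2 * a * b * mutual_energy X \<mu> \<nu> + b\<^sup>2 * energy X \<nu>"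
  unfolding energy_def mutual_energy_lincomb_left[OF assms signed_measures_lincomb[OF assms]]
    mutual_energy_lincomb_right[OF assms(1) assms] mutual_energy_lincomb_right[OF assms(2) assms]
    mutual_energy_commute[OF assms(2,1)]
  by (simp add: algebra_simps power2_eq_square)

end

section \<open>The energy seminorm\<close>

text \<open>For \<open>s > 0\<close> the bound is evaluated at the vertex \<open>t = q / s\<close>
  of the parabola. For \<open>s = 0\<close> the left side is affine in t, and boundedness forces
  \<open>q = 0\<close>.\<close>

lemma abs_le_sqrt_of_quadratic_bound:
  fixes p q s m :: real
  assumes "0 \<le> s" and le: "\<And>t. p + 2 * t * q - t\<^sup>2 * s \<le> m"
  shows "\<bar>q\<bar> \<le> sqrt (m - p) * sqrt s"
proof -
  have "q\<^sup>2 \<le> (m - p) * s"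
  proof (cases "s = 0")
    case True
    have "q = 0"
    proof (rule ccontr)
      assume "q \<noteq> 0"
      \<comment> \<open>This t makes the affine function equal to \<open>m + 1\<close>.\<close>
      then have "2 * ((m - p + 1) / (2 * q)) * q = m - p + 1" by simp
      then show False using le[of "(m - p + 1) / (2 * q)"] True by simp
    qed
    then show ?thesis using True by simp
  next
    case False
    with \<open>0 \<le> s\<close> have "s > 0" by simp
    then have "2 * (q / s) * q - (q / s)\<^sup>2 * s = q\<^sup>2 / s" by (simp add: power2_eq_square)
    then have "p + q\<^sup>2 / s \<le> m" using le[of "q / s"] by linarith
    with \<open>s > 0\<close> show ?thesis by (simp add: field_simps)
  qed
  then have "sqrt (q\<^sup>2) \<le> sqrt ((m - p) * s)" by (rule real_sqrt_le_mono)
  then show ?thesis by (simp add: real_sqrt_mult)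
qed

context
  fixes X :: "'a::metric_space set"
  assumes X: "compact X" and qh: "quasihypermetric X"
begin

lemma signed_measures_0D: "\<nu> \<in> signed_measures_0 X \<Longrightarrow> \<nu> \<in> signed_measures X"
  by (simp add: signed_measures_0_def)

lemma signed_measures_1D: "\<nu> \<in> signed_measures_1 X \<Longrightarrow> \<nu> \<in> signed_measures X"
  by (simp add: signed_measures_1_def)

lemma prob_measuresD: "\<nu> \<in> prob_measures X \<Longrightarrow> \<nu> \<in> signed_measures_1 X"
  by (simp add: prob_measures_def)

lemma seminorm_nonneg: "\<nu> \<in> signed_measures_0 X \<Longrightarrow> 0 \<le> energy_seminorm X \<nu>"
  using energy_nonpos[OF X qh] by (simp add: energy_seminorm_def)

lemma seminorm_square: "\<nu> \<in> signed_measures_0 X \<Longrightarrow> (energy_seminorm X \<nu>)\<^sup>2 = - energy X \<nu>"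
  using energy_nonpos[OF X qh] by (simp add: energy_seminorm_def)

lemma seminorm_scale:
  assumes "\<nu> \<in> signed_measures X"
  shows "energy_seminorm X (\<lambda>A. a * \<nu> A) = \<bar>a\<bar> * energy_seminorm X \<nu>"
proof -
  have "- energy X (\<lambda>A. a * \<nu> A) = a\<^sup>2 * - energy X \<nu>"
    using energy_lincomb[OF X assms assms, of a 0] by simp
  then show ?thesis by (simp only: energy_seminorm_def real_sqrt_mult real_sqrt_abs)
qed

text \<open>The quadratic bound with \<open>m = 0\<close>: every \<mu> + t \<nu> has mass 0 and
  hence nonpositive energy.\<close>

lemma seminorm_Cauchy_Schwarz:
  assumes \<mu>: "\<mu> \<in> signed_measures_0 X" and \<nu>: "\<nu> \<in> signed_measures_0 X"
  shows "\<bar>mutual_energy X \<mu> \<nu>\<bar> \<le> energy_seminorm X \<mu> * energy_seminorm X \<nu>"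
proof -
  have "\<bar>mutual_energy X \<mu> \<nu>\<bar> \<le> sqrt (0 - energy X \<mu>) * sqrt (- energy X \<nu>)"
  proof (rule abs_le_sqrt_of_quadratic_bound)
    show "0 \<le> - energy X \<nu>" using energy_nonpos[OF X qh \<nu>] by simp
    fix t
    have "(\<lambda>A. 1 * \<mu> A + t * \<nu> A) \<in> signed_measures_0 X"
      using signed_measures_lincomb[OF signed_measures_0D[OF \<mu>] signed_measures_0D[OF \<nu>], of 1 t] \<mu> \<nu>
      by (simp add: signed_measures_0_def)
    from energy_nonpos[OF X qh this]
    show "energy X \<mu> + 2 * t * mutual_energy X \<mu> \<nu> - t\<^sup>2 * - energy X \<nu> \<le> 0"
      unfolding energy_lincomb[OF X signed_measures_0D[OF \<mu>] signed_measures_0D[OF \<nu>]] by simp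
  qed
  then show ?thesis by (simp add: energy_seminorm_def)
qed

text \<open>The line \<mu> + t \<nu> stays among the measures of mass 1, so the quadratic bound
  applies with \<open>m = M\<close>.\<close>

lemma bounded_energy_imp_mutual_energy_le:
  assumes M: "\<And>\<mu>. \<mu> \<in> signed_measures_1 X \<Longrightarrow> energy X \<mu> \<le> M"
    and \<mu>: "\<mu> \<in> signed_measures_1 X" and \<nu>: "\<nu> \<in> signed_measures_0 X"
  shows "\<bar>mutual_energy X \<mu> \<nu>\<bar> \<le> sqrt (M - energy X \<mu>) * energy_seminorm X \<nu>"
  unfolding energy_seminorm_def
proof (rule abs_le_sqrt_of_quadratic_bound)
  show "0 \<le> - energy X \<nu>" using energy_nonpos[OF X qh \<nu>] by simp
  fix t
  have "(\<lambda>A. 1 * \<mu> A + t * \<nu> A) \<in> signed_measures_1 X"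
    using signed_measures_lincomb[OF signed_measures_1D[OF \<mu>] signed_measures_0D[OF \<nu>], of 1 t] \<mu> \<nu>
    by (simp add: signed_measures_0_def signed_measures_1_def)
  from M[OF this] show "energy X \<mu> + 2 * t * mutual_energy X \<mu> \<nu> - t\<^sup>2 * - energy X \<nu> \<le> M"
    unfolding energy_lincomb[OF X signed_measures_1D[OF \<mu>] signed_measures_0D[OF \<nu>]] by simp
qed

lemma mutual_energy_le_imp_bounded_energy:
  assumes \<mu>: "\<mu> \<in> signed_measures_1 X"
    and c: "\<And>\<nu>. \<nu> \<in> signed_measures_0 X \<Longrightarrow> \<bar>mutual_energy X \<mu> \<nu>\<bar> \<le> c * energy_seminorm X \<nu>"
    and \<mu>': "\<mu>' \<in> signed_measures_1 X"
  shows "energy X \<mu>' \<le> energy X \<mu> + c\<^sup>2"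
proof -
  define \<nu> where "\<nu> = (\<lambda>A. 1 * \<mu>' A + (- 1) * \<mu> A)"
  have \<nu>: "\<nu> \<in> signed_measures_0 X"
    using signed_measures_lincomb[OF signed_measures_1D[OF \<mu>'] signed_measures_1D[OF \<mu>], of 1 "- 1"] \<mu> \<mu>'
    by (simp add: \<nu>_def signed_measures_0_def signed_measures_1_def)
  have "\<mu>' = (\<lambda>A. 1 * \<mu> A + 1 * \<nu> A)" by (simp add: \<nu>_def fun_eq_iff)
  then have "energy X \<mu>' = energy X \<mu> + 2 * mutual_energy X \<mu> \<nu> + energy X \<nu>"
    using energy_lincomb[OF X signed_measures_1D[OF \<mu>] signed_measures_0D[OF \<nu>], of 1 1] by simp
  also have "\<dots> \<le> energy X \<mu> + 2 * (c * energy_seminorm X \<nu>) - (energy_seminorm X \<nu>)\<^sup>2"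
    using c[OF \<nu>] seminorm_square[OF \<nu>] by simp
  \<comment> \<open>Completing the square, with s the seminorm of \<nu>:
    \<open>2 * c * s - s^2 = c^2 - (c - s)^2\<close>.\<close>
  also have "\<dots> \<le> energy X \<mu> + c\<^sup>2"
    using zero_le_power2[of "c - energy_seminorm X \<nu>"] by (simp add: power2_diff)
  finally show ?thesis .
qed

text \<open>Subtracting \<open>\<mu>' X\<close> times \<mu> from \<open>\<mu>'\<close> leaves \<rho>
  of mass 0. The hypothesis bounds the multiple of \<mu>, and the Cauchy-Schwarz inequality bounds
  \<rho>.\<close>

lemma mutual_energy_le_transfer:
  assumes \<mu>: "\<mu> \<in> signed_measures_1 X"
    and c: "\<And>\<nu>. \<nu> \<in> signed_measures_0 X \<Longrightarrow> \<bar>mutual_energy X \<mu> \<nu>\<bar> \<le> c * energy_seminorm X \<nu>"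
    and \<mu>': "\<mu>' \<in> signed_measures X"
  shows "\<exists>c'\<ge>0. \<forall>\<nu>\<in>signed_measures_0 X. \<bar>mutual_energy X \<mu>' \<nu>\<bar> \<le> c' * energy_seminorm X \<nu>"
proof (intro exI conjI ballI)
  define m where "m = \<mu>' X"
  define \<rho> where "\<rho> = (\<lambda>A. 1 * \<mu>' A + (- m) * \<mu> A)"
  note \<mu>s = signed_measures_1D[OF \<mu>]
  have \<rho>: "\<rho> \<in> signed_measures_0 X"
    using signed_measures_lincomb[OF \<mu>' \<mu>s, of 1 "- m"] \<mu>
    by (simp add: \<rho>_def signed_measures_0_def signed_measures_1_def m_def)
  define c' where "c' = \<bar>m * c\<bar> + energy_seminorm X \<rho>"
  show "c' \<ge> 0" using seminorm_nonneg[OF \<rho>] by (simp add: c'_def)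
  fix \<nu> assume \<nu>: "\<nu> \<in> signed_measures_0 X"
  have "\<mu>' = (\<lambda>A. m * \<mu> A + 1 * \<rho> A)" by (simp add: \<rho>_def fun_eq_iff)
  then have "mutual_energy X \<mu>' \<nu> = m * mutual_energy X \<mu> \<nu> + mutual_energy X \<rho> \<nu>"
    using mutual_energy_lincomb_left[OF X \<mu>s signed_measures_0D[OF \<rho>] signed_measures_0D[OF \<nu>], of m 1]
    by simp
  then have "\<bar>mutual_energy X \<mu>' \<nu>\<bar> \<le> \<bar>m\<bar> * \<bar>mutual_energy X \<mu> \<nu>\<bar> + \<bar>mutual_energy X \<rho> \<nu>\<bar>"
    using abs_triangle_ineq[of "m * mutual_energy X \<mu> \<nu>"] by (simp add: abs_mult)
  \<comment> \<open>The modulus of \<open>c\<close> appears because its sign is not assumed.\<close>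
  also have "\<dots> \<le> \<bar>m\<bar> * (\<bar>c\<bar> * energy_seminorm X \<nu>) + energy_seminorm X \<rho> * energy_seminorm X \<nu>"
  proof (intro add_mono mult_left_mono seminorm_Cauchy_Schwarz \<rho> \<nu>)
    show "\<bar>mutual_energy X \<mu> \<nu>\<bar> \<le> \<bar>c\<bar> * energy_seminorm X \<nu>"
      using c[OF \<nu>] mult_right_mono[OF abs_ge_self seminorm_nonneg[OF \<nu>], of c] by linarith
  qed simp
  also have "\<dots> = c' * energy_seminorm X \<nu>" by (simp add: c'_def abs_mult algebra_simps)
  finally show "\<bar>mutual_energy X \<mu>' \<nu>\<bar> \<le> c' * energy_seminorm X \<nu>" .
qed

text \<open>Apply the hypothesis to the midpoints of \<open>\<mu>\<close> with two probability measures \<open>\<nu>\<^sub>1\<close>, \<open>\<nu>\<^sub>2\<close>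
  and to \<open>\<nu>\<^sub>1\<close>, \<open>\<nu>\<^sub>2\<close> themselves; every element of \<open>\<M>\<^sub>0\<close> is a multiple of such a difference.\<close>

lemma energy_difference_imp_mutual_energy_le:
  assumes c: "\<And>\<mu>\<^sub>1 \<mu>\<^sub>2. \<mu>\<^sub>1 \<in> prob_measures X \<Longrightarrow> \<mu>\<^sub>2 \<in> prob_measures X \<Longrightarrow>
      \<bar>energy X \<mu>\<^sub>1 - energy X \<mu>\<^sub>2\<bar> \<le> c * energy_seminorm X (\<mu>\<^sub>1 - \<mu>\<^sub>2)"
    and \<mu>: "\<mu> \<in> prob_measures X" and \<nu>: "\<nu> \<in> signed_measures_0 X"
  shows "\<bar>mutual_energy X \<mu> \<nu>\<bar> \<le> 3 / 2 * c * energy_seminorm X \<nu>"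
proof -
  have conv: "(\<lambda>A. (1/2) * \<mu> A + (1/2) * \<nu> A) \<in> prob_measures X" if "\<nu> \<in> prob_measures X" for \<nu>
    using that \<mu> signed_measures_lincomb[of \<mu> X \<nu> "1/2" "1/2"]
    by (auto simp: prob_measures_def signed_measures_1_def)
  note s = signed_measures_1D[OF prob_measuresD]
  have prob: "\<bar>mutual_energy X \<mu> (\<nu>\<^sub>1 - \<nu>\<^sub>2)\<bar> \<le> 3 / 2 * c * energy_seminorm X (\<nu>\<^sub>1 - \<nu>\<^sub>2)"
    if \<nu>1: "\<nu>\<^sub>1 \<in> prob_measures X" and \<nu>2: "\<nu>\<^sub>2 \<in> prob_measures X" for \<nu>\<^sub>1 \<nu>\<^sub>2
  proof -
    \<comment> \<open>In the difference of the energies of the midpoints the term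
      \<open>energy X \<mu>\<close> cancels, while the mixed terms leave half of the wanted mutual
      energy.\<close>
    let ?\<mu>\<^sub>1 = "\<lambda>A. (1/2) * \<mu> A + (1/2) * \<nu>\<^sub>1 A" and ?\<mu>\<^sub>2 = "\<lambda>A. (1/2) * \<mu> A + (1/2) * \<nu>\<^sub>2 A"
    have diff: "\<nu>\<^sub>1 - \<nu>\<^sub>2 = (\<lambda>A. 1 * \<nu>\<^sub>1 A + (- 1) * \<nu>\<^sub>2 A)" by (simp add: fun_eq_iff)
    have "?\<mu>\<^sub>1 - ?\<mu>\<^sub>2 = (\<lambda>A. (1/2) * (\<nu>\<^sub>1 - \<nu>\<^sub>2) A)" by (simp add: fun_eq_iff algebra_simps)
    moreover have "\<nu>\<^sub>1 - \<nu>\<^sub>2 \<in> signed_measures X"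
      unfolding diff by (intro signed_measures_lincomb s \<nu>1 \<nu>2)
    ultimately have norm: "energy_seminorm X (?\<mu>\<^sub>1 - ?\<mu>\<^sub>2) = 1 / 2 * energy_seminorm X (\<nu>\<^sub>1 - \<nu>\<^sub>2)"
      using seminorm_scale[of "\<nu>\<^sub>1 - \<nu>\<^sub>2" "1/2"] by simp
    have "\<bar>energy X ?\<mu>\<^sub>1 - energy X ?\<mu>\<^sub>2\<bar> \<le> c * (1 / 2 * energy_seminorm X (\<nu>\<^sub>1 - \<nu>\<^sub>2))"
      using c[OF conv[OF \<nu>1] conv[OF \<nu>2]] unfolding norm .
    also have "energy X ?\<mu>\<^sub>1 - energy X ?\<mu>\<^sub>2 =
        1 / 2 * mutual_energy X \<mu> (\<nu>\<^sub>1 - \<nu>\<^sub>2) + 1 / 4 * (energy X \<nu>\<^sub>1 - energy X \<nu>\<^sub>2)"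
      unfolding diff mutual_energy_lincomb_right[OF X s[OF \<mu>] s[OF \<nu>1] s[OF \<nu>2]]
        energy_lincomb[OF X s[OF \<mu>] s[OF \<nu>1]] energy_lincomb[OF X s[OF \<mu>] s[OF \<nu>2]]
      by (simp add: algebra_simps power2_eq_square)
    finally have "\<bar>1 / 2 * mutual_energy X \<mu> (\<nu>\<^sub>1 - \<nu>\<^sub>2) + 1 / 4 * (energy X \<nu>\<^sub>1 - energy X \<nu>\<^sub>2)\<bar>
        \<le> 1 / 2 * (c * energy_seminorm X (\<nu>\<^sub>1 - \<nu>\<^sub>2))" by (simp only: mult.left_commute)
    \<comment> \<open>The origin of 3/2: half of \<open>\<bar>m\<bar>\<close> is at most
      \<open>t / 2\<close> from the midpoints plus \<open>t / 4\<close> from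
      \<open>\<nu>\<^sub>1\<close> and \<open>\<nu>\<^sub>2\<close> themselves.\<close>
    moreover have "\<bar>m\<bar> \<le> 3 / 2 * t" if "\<bar>1 / 2 * m + 1 / 4 * d\<bar> \<le> 1 / 2 * t" "\<bar>d\<bar> \<le> t" for m d t :: real
      using that by linarith
    ultimately show ?thesis unfolding mult.assoc[of "3 / 2"] using c[OF \<nu>1 \<nu>2] by blast
  qed
  note \<nu>s = signed_measures_0D[OF \<nu>]
  let ?P = "pos_variation X \<nu>" and ?N = "neg_variation X \<nu>"
  have XX: "X \<in> sets (borel_on X)" using sets.top[of "borel_on X"] by (simp add: space_restrict_space)
  define a where "a = measure ?P X"
  \<comment> \<open>As \<nu> has mass 0, its two Jordan parts have the same mass, so one factor
    \<open>a\<close> normalises both.\<close>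
  have aN: "a = measure ?N X"
    using Jordan_decomposition[OF \<nu>s XX] \<nu> by (simp add: a_def signed_measures_0_def)
  have P: "measure ?P \<in> signed_measures X" and N: "measure ?N \<in> signed_measures X"
    using measure_in_signed_measures[OF finite_measure_pos_variation[OF \<nu>s] sets_pos_variation]
      measure_in_signed_measures[OF finite_measure_neg_variation[OF \<nu>s] sets_neg_variation] .
  \<comment> \<open>Valid also for non-measurable sets, where all three values are 0, so it yields
    equality of functions.\<close>
  have \<nu>eq: "\<nu> A = measure ?P A - measure ?N A" for A
  proof (cases "A \<in> sets (borel_on X)")
    case False
    then have "\<nu> A = 0" using \<nu>s by (simp add: signed_measures_def)
    with False show ?thesis by (simp add: measure_notin_sets)
  qed (rule Jordan_decomposition[OF \<nu>s])
  show ?thesis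
  proof (cases "a = 0")
    case True
    have zero: "measure ?P A = 0" "measure ?N A = 0" for A
      using finite_measure.bounded_measure[OF finite_measure_pos_variation[OF \<nu>s], of A]
        finite_measure.bounded_measure[OF finite_measure_neg_variation[OF \<nu>s], of A] True aN
      by (auto simp: a_def intro!: antisym)
    \<comment> \<open>Writing the zero measure as a trivial linear combination lets bilinearity show
      that both sides of the claim vanish.\<close>
    then have "\<nu> = (\<lambda>A. 0 * \<nu> A + 0 * \<nu> A)" by (simp add: fun_eq_iff \<nu>eq)
    then have "mutual_energy X \<mu> \<nu> = 0" "energy X \<nu> = 0"
      using mutual_energy_lincomb_right[OF X s[OF \<mu>] \<nu>s \<nu>s, of 0 0] energy_lincomb[OF X \<nu>s \<nu>s, of 0 0] by auto
    then show ?thesis by (simp add: energy_seminorm_def)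
  next
    case False
    then have "a > 0" using measure_nonneg[of ?P X] by (simp add: a_def less_le)
    define \<nu>\<^sub>1 where "\<nu>\<^sub>1 = (\<lambda>A. (1 / a) * measure ?P A + 0 * measure ?P A)"
    define \<nu>\<^sub>2 where "\<nu>\<^sub>2 = (\<lambda>A. (1 / a) * measure ?N A + 0 * measure ?N A)"
    have p: "\<nu>\<^sub>1 \<in> prob_measures X" "\<nu>\<^sub>2 \<in> prob_measures X"
      using signed_measures_lincomb[OF P P, of "1 / a" 0] signed_measures_lincomb[OF N N, of "1 / a" 0] \<open>a > 0\<close>
      by (auto simp: \<nu>\<^sub>1_def \<nu>\<^sub>2_def prob_measures_def signed_measures_1_def a_def[symmetric] aN[symmetric])
    define \<rho> where "\<rho> = \<nu>\<^sub>1 - \<nu>\<^sub>2"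
    have \<rho>: "\<rho> \<in> signed_measures X"
      using signed_measures_lincomb[OF s[OF p(1)] s[OF p(2)], of 1 "- 1"]
      by (simp add: \<rho>_def fun_diff_def)
    have "\<nu> = (\<lambda>A. a * \<rho> A + 0 * \<rho> A)"
      using \<open>a > 0\<close> by (simp add: fun_eq_iff \<rho>_def \<nu>\<^sub>1_def \<nu>\<^sub>2_def \<nu>eq right_diff_distrib)
    then have "mutual_energy X \<mu> \<nu> = a * mutual_energy X \<mu> \<rho>" "energy_seminorm X \<nu> = a * energy_seminorm X \<rho>"
      using mutual_energy_lincomb_right[OF X s[OF \<mu>] \<rho> \<rho>, of a 0] seminorm_scale[OF \<rho>, of a] \<open>a > 0\<close>
      by simp_all
    moreover have "a * \<bar>mutual_energy X \<mu> \<rho>\<bar> \<le> a * (3 / 2 * c * energy_seminorm X \<rho>)"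
      using prob[OF p] \<open>a > 0\<close> unfolding \<rho>_def by (intro mult_left_mono) auto
    ultimately show ?thesis using \<open>a > 0\<close> by (simp add: abs_mult mult_ac)
  qed
qed

section \<open>The supremum norm of potentials and finiteness of the maximal energy\<close>

lemma sup_norm_potential_le:
  assumes "X \<noteq> {}" and "\<And>x. x \<in> X \<Longrightarrow> \<bar>potential X \<nu> x\<bar> \<le> c"
  shows "sup_norm_on X (potential X \<nu>) \<le> c"
  unfolding sup_norm_on_def by (rule cSUP_least[OF assms])

text \<open>\<open>potential_bound\<close> makes the set of values bounded above, so that the real
  supremum is a genuine upper bound.\<close>

lemma abs_potential_le_sup_norm:
  assumes "\<nu> \<in> signed_measures X" "x \<in> X"
  shows "\<bar>potential X \<nu> x\<bar> \<le> sup_norm_on X (potential X \<nu>)"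
  unfolding sup_norm_on_def
  by (rule cSUP_upper[OF assms(2) bdd_aboveI2[OF potential_bound[OF X assms(1)]]])

end

lemma max_energy_finite_iff:
  "max_energy X < \<infinity> \<longleftrightarrow> (\<exists>M. \<forall>\<mu>\<in>signed_measures_1 X. energy X \<mu> \<le> M)"
proof
  assume "max_energy X < \<infinity>"
  then obtain M where "max_energy X \<le> ereal M" by (cases "max_energy X") auto
  then show "\<exists>M. \<forall>\<mu>\<in>signed_measures_1 X. energy X \<mu> \<le> M"
    unfolding max_energy_def SUP_le_iff by (intro exI[of _ M]) simp
next
  assume "\<exists>M. \<forall>\<mu>\<in>signed_measures_1 X. energy X \<mu> \<le> M"
  then obtain M where "\<forall>\<mu>\<in>signed_measures_1 X. energy X \<mu> \<le> M" ..
  then have "max_energy X \<le> ereal M" unfolding max_energy_def by (intro SUP_least) simp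
  then show "max_energy X < \<infinity>" by (rule order_le_less_trans) simp
qed

section \<open>The implications between the six conditions\<close>

theorem theorem5p3:
  fixes X :: "'a::metric_space set"
  assumes "compact X" and "X \<noteq> {}" and "quasihypermetric X"
  shows
    "(max_energy X < \<infinity> \<longleftrightarrow>
        (\<exists>\<mu>\<in>signed_measures_1 X. \<exists>c\<ge>0. \<forall>\<nu>\<in>signed_measures_0 X.
           \<bar>mutual_energy X \<mu> \<nu>\<bar> \<le> c * energy_seminorm X \<nu>)) \<and>
     (max_energy X < \<infinity> \<longleftrightarrow>
        (\<forall>\<mu>\<in>signed_measures X. \<exists>c\<ge>0. \<forall>\<nu>\<in>signed_measures_0 X.
           \<bar>mutual_energy X \<mu> \<nu>\<bar> \<le> c * energy_seminorm X \<nu>)) \<and>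
     (max_energy X < \<infinity> \<longleftrightarrow>
        (\<exists>K\<ge>0. \<forall>\<nu>\<in>signed_measures_0 X. \<forall>\<mu>\<in>prob_measures X.
           \<bar>mutual_energy X \<mu> \<nu>\<bar> \<le> K * energy_seminorm X \<nu>)) \<and>
     (max_energy X < \<infinity> \<longleftrightarrow>
        (\<exists>c\<ge>0. \<forall>\<nu>\<in>signed_measures_0 X.
           sup_norm_on X (potential X \<nu>) \<le> c * energy_seminorm X \<nu>)) \<and>
     (max_energy X < \<infinity> \<longleftrightarrow>
        (\<exists>c\<ge>0. \<forall>\<mu>\<^sub>1\<in>prob_measures X. \<forall>\<mu>\<^sub>2\<in>prob_measures X.
           \<bar>energy X \<mu>\<^sub>1 - energy X \<mu>\<^sub>2\<bar> \<le> c * energy_seminorm X (\<mu>\<^sub>1 - \<mu>\<^sub>2)))"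
proof -
  note X = assms(1) and qh = assms(3)
  obtain x where x: "x \<in> X" using assms(2) by blast
  obtain \<delta> where \<delta>: "\<delta> \<in> prob_measures X"
    and \<delta>_eq: "\<And>\<nu>. \<nu> \<in> signed_measures X \<Longrightarrow> mutual_energy X \<delta> \<nu> = potential X \<nu> x"
    using dirac_measure[OF X x] by blast
  have \<delta>1: "\<delta> \<in> signed_measures_1 X" by (rule prob_measuresD[OF X qh \<delta>])
  have \<delta>s: "\<delta> \<in> signed_measures X" by (rule signed_measures_1D[OF X qh \<delta>1])
  let ?c1 = "max_energy X < \<infinity>"
  let ?c2 = "\<exists>\<mu>\<in>signed_measures_1 X. \<exists>c\<ge>0. \<forall>\<nu>\<in>signed_measures_0 X.
    \<bar>mutual_energy X \<mu> \<nu>\<bar> \<le> c * energy_seminorm X \<nu>"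
  let ?c3 = "\<forall>\<mu>\<in>signed_measures X. \<exists>c\<ge>0. \<forall>\<nu>\<in>signed_measures_0 X.
    \<bar>mutual_energy X \<mu> \<nu>\<bar> \<le> c * energy_seminorm X \<nu>"
  let ?c4 = "\<exists>K\<ge>0. \<forall>\<nu>\<in>signed_measures_0 X. \<forall>\<mu>\<in>prob_measures X.
    \<bar>mutual_energy X \<mu> \<nu>\<bar> \<le> K * energy_seminorm X \<nu>"
  let ?c5 = "\<exists>c\<ge>0. \<forall>\<nu>\<in>signed_measures_0 X.
    sup_norm_on X (potential X \<nu>) \<le> c * energy_seminorm X \<nu>"
  let ?c6 = "\<exists>c\<ge>0. \<forall>\<mu>\<^sub>1\<in>prob_measures X. \<forall>\<mu>\<^sub>2\<in>prob_measures X.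
    \<bar>energy X \<mu>\<^sub>1 - energy X \<mu>\<^sub>2\<bar> \<le> c * energy_seminorm X (\<mu>\<^sub>1 - \<mu>\<^sub>2)"
  \<comment> \<open>A fact named by two digits takes the first condition to the second. The cycle is
    1-4-2-1; condition 3 is attached through 2-3-2, and conditions 5 and 6 through 4-5-2 and
    4-6-2.\<close>
  have 14: ?c4 if ?c1
  proof -
    from that obtain M where M: "\<And>\<mu>. \<mu> \<in> signed_measures_1 X \<Longrightarrow> energy X \<mu> \<le> M"
      unfolding max_energy_finite_iff by blast
    have "0 \<le> M" using energy_prob_nonneg[OF X \<delta>] M[OF \<delta>1] by linarith
    have "\<bar>mutual_energy X \<mu> \<nu>\<bar> \<le> sqrt M * energy_seminorm X \<nu>"
      if "\<nu> \<in> signed_measures_0 X" "\<mu> \<in> prob_measures X" for \<mu> \<nu>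
    proof -
      have "\<bar>mutual_energy X \<mu> \<nu>\<bar> \<le> sqrt (M - energy X \<mu>) * energy_seminorm X \<nu>"
        using bounded_energy_imp_mutual_energy_le[OF X qh M prob_measuresD[OF X qh that(2)] that(1)] .
      also have "\<dots> \<le> sqrt M * energy_seminorm X \<nu>"
        using energy_prob_nonneg[OF X that(2)] seminorm_nonneg[OF X qh that(1)]
        by (intro mult_right_mono real_sqrt_le_mono) auto
      finally show ?thesis .
    qed
    then show ?c4 using \<open>0 \<le> M\<close> by (intro exI[of _ "sqrt M"]) auto
  qed
  \<comment> \<open>Conditions 3 to 6 all return to 2 with the point mass \<delta> as witness: it is
    a probability measure, and its mutual energy with \<nu> is a value of the potential of
    \<nu>.\<close>
  have \<delta>2: ?c2 if "c \<ge> 0" "\<And>\<nu>. \<nu> \<in> signed_measures_0 X \<Longrightarrow> \<bar>mutual_energy X \<delta> \<nu>\<bar> \<le> c * energy_seminorm X \<nu>" for c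
    using that \<delta>1 by blast
  have 42: ?c2 if ?c4 using that \<delta> \<delta>2 by blast
  have 21: ?c1 if ?c2
  proof -
    from that obtain \<mu> c where "\<mu> \<in> signed_measures_1 X"
      "\<And>\<nu>. \<nu> \<in> signed_measures_0 X \<Longrightarrow> \<bar>mutual_energy X \<mu> \<nu>\<bar> \<le> c * energy_seminorm X \<nu>" by blast
    from mutual_energy_le_imp_bounded_energy[OF X qh this] show ?c1
      unfolding max_energy_finite_iff by blast
  qed
  have 23: ?c3 if ?c2
  proof
    fix \<mu>' assume \<mu>': "\<mu>' \<in> signed_measures X"
    from that obtain \<mu> c where "\<mu> \<in> signed_measures_1 X"
      "\<And>\<nu>. \<nu> \<in> signed_measures_0 X \<Longrightarrow> \<bar>mutual_energy X \<mu> \<nu>\<bar> \<le> c * energy_seminorm X \<nu>" by blast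
    from mutual_energy_le_transfer[OF X qh this \<mu>']
    show "\<exists>c\<ge>0. \<forall>\<nu>\<in>signed_measures_0 X. \<bar>mutual_energy X \<mu>' \<nu>\<bar> \<le> c * energy_seminorm X \<nu>" .
  qed
  have 32: ?c2 if ?c3 using that \<delta>s \<delta>2 by blast
  have 45: ?c5 if ?c4
  proof -
    from that obtain K where K: "K \<ge> 0" "\<And>\<mu> \<nu>. \<nu> \<in> signed_measures_0 X \<Longrightarrow> \<mu> \<in> prob_measures X \<Longrightarrow>
        \<bar>mutual_energy X \<mu> \<nu>\<bar> \<le> K * energy_seminorm X \<nu>" by blast
    have "sup_norm_on X (potential X \<nu>) \<le> K * energy_seminorm X \<nu>" if \<nu>: "\<nu> \<in> signed_measures_0 X" for \<nu>
    proof (rule sup_norm_potential_le[OF X qh assms(2)])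
      fix y assume "y \<in> X"
      from dirac_measure[OF X this] obtain \<delta>' where
        "\<delta>' \<in> prob_measures X" "mutual_energy X \<delta>' \<nu> = potential X \<nu> y"
        using signed_measures_0D[OF X qh \<nu>] by blast
      then show "\<bar>potential X \<nu> y\<bar> \<le> K * energy_seminorm X \<nu>" using K(2)[OF \<nu>] by metis
    qed
    with K(1) show ?c5 by blast
  qed
  have 52: ?c2 if ?c5
  proof -
    from that obtain c where c: "c \<ge> 0" "\<And>\<nu>. \<nu> \<in> signed_measures_0 X \<Longrightarrow>
        sup_norm_on X (potential X \<nu>) \<le> c * energy_seminorm X \<nu>" by blast
    show ?c2
    proof (rule \<delta>2[OF c(1)])
      fix \<nu> assume \<nu>: "\<nu> \<in> signed_measures_0 X"
      note \<nu>s = signed_measures_0D[OF X qh \<nu>]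
      show "\<bar>mutual_energy X \<delta> \<nu>\<bar> \<le> c * energy_seminorm X \<nu>"
        unfolding \<delta>_eq[OF \<nu>s] using abs_potential_le_sup_norm[OF X qh \<nu>s x] c(2)[OF \<nu>] by (rule order_trans)
    qed
  qed
  have 46: ?c6 if ?c4
  proof -
    from that obtain K where K: "K \<ge> 0" "\<And>\<mu> \<nu>. \<nu> \<in> signed_measures_0 X \<Longrightarrow> \<mu> \<in> prob_measures X \<Longrightarrow>
        \<bar>mutual_energy X \<mu> \<nu>\<bar> \<le> K * energy_seminorm X \<nu>" by blast
    have "\<bar>energy X \<mu>\<^sub>1 - energy X \<mu>\<^sub>2\<bar> \<le> (2 * K) * energy_seminorm X (\<mu>\<^sub>1 - \<mu>\<^sub>2)"
      if p: "\<mu>\<^sub>1 \<in> prob_measures X" "\<mu>\<^sub>2 \<in> prob_measures X" for \<mu>\<^sub>1 \<mu>\<^sub>2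
    proof -
      note s = p[THEN prob_measuresD[OF X qh], THEN signed_measures_1D[OF X qh]]
      have diff: "\<mu>\<^sub>1 - \<mu>\<^sub>2 = (\<lambda>A. 1 * \<mu>\<^sub>1 A + (- 1) * \<mu>\<^sub>2 A)" by (simp add: fun_eq_iff)
      have d0: "\<mu>\<^sub>1 - \<mu>\<^sub>2 \<in> signed_measures_0 X"
        using signed_measures_lincomb[OF s, of 1 "- 1"] p
        unfolding diff by (simp add: signed_measures_0_def prob_measures_def signed_measures_1_def)
      have "energy X \<mu>\<^sub>1 - energy X \<mu>\<^sub>2 = mutual_energy X \<mu>\<^sub>1 (\<mu>\<^sub>1 - \<mu>\<^sub>2) + mutual_energy X \<mu>\<^sub>2 (\<mu>\<^sub>1 - \<mu>\<^sub>2)"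
        unfolding diff mutual_energy_lincomb_right[OF X s(1) s] mutual_energy_lincomb_right[OF X s(2) s]
        by (simp add: energy_def mutual_energy_commute[OF X s])
      then show ?thesis using K(2)[OF d0 p(1)] K(2)[OF d0 p(2)] by (simp add: abs_le_iff)
    qed
    then show ?c6 using K(1) by (intro exI[of _ "2 * K"]) auto
  qed
  have 62: ?c2 if ?c6
  proof -
    from that obtain c where c: "c \<ge> 0" "\<And>\<mu>\<^sub>1 \<mu>\<^sub>2. \<mu>\<^sub>1 \<in> prob_measures X \<Longrightarrow> \<mu>\<^sub>2 \<in> prob_measures X \<Longrightarrow>
      \<bar>energy X \<mu>\<^sub>1 - energy X \<mu>\<^sub>2\<bar> \<le> c * energy_seminorm X (\<mu>\<^sub>1 - \<mu>\<^sub>2)" by blast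
    show ?c2
      using energy_difference_imp_mutual_energy_le[OF X qh c(2) \<delta>] c(1)
      by (intro \<delta>2[of "3 / 2 * c"]) auto
  qed
  have "?c1 \<longleftrightarrow> ?c2" using 14 42 21 by (iprover intro: iffI)
  moreover have "?c1 \<longleftrightarrow> ?c3" using 14 42 21 23 32 by (iprover intro: iffI)
  moreover have "?c1 \<longleftrightarrow> ?c4" using 14 42 21 by (iprover intro: iffI)
  moreover have "?c1 \<longleftrightarrow> ?c5" using 14 21 45 52 by (iprover intro: iffI)
  moreover have "?c1 \<longleftrightarrow> ?c6" using 14 21 46 62 by (iprover intro: iffI)
  ultimately show ?thesis by (intro conjI)
qed

end
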